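(* Let $V$ be a finite-dimensional irreducible $\boxtimes$-module over $\mathbb F$. Then for $\sigma\in G$ the $\boxtimes$-module $V$ twisted via $\sigma$ is isomorphic to the $\boxtimes$-module $V$.
   Context: $\mathbb F$ is an algebraically closed field of characteristic $0$, and $\mathbb I=\{0,1,2,3\}$. The tetrahedron algebra $\boxtimes$ is the Lie algebra over $\mathbb F$ with generators $\{x_{ij}\mid i,j\in\mathbb I,\ i\ne j\}$ and relations: (i) $x_{ij}+x_{ji}=0$ for distinct $i,j$; (ii) $[x_{ij},x_{jk}]=2x_{ij}+2x_{jk}$ for mutually distinct $i,j,k$; (iii) $[x_{ij},[x_{ij},[x_{ij},x_{k\ell}]]]=4[x_{ij},x_{k\ell}]$ for mutually distinct $i,j,k,\ell$. $S_4$ is the group of permutations of $\mathbb I$. It acts on $\boxtimes$ by Lie algebra automorphisms with $\sigma(x_{ij})=x_{\sigma(i),\sigma(j)}$. For a $\boxtimes$-module $V$ and $\sigma\in S_4$, "$V$ twisted via $\sigma$" is the $\boxtimes$-module on the same vector space in which $\xi\in\boxtimes$ acts as $\sigma^{-1}(\xi)$ acts on the original $V$. $G$ is the subgroup of $S_4$ consisting of the identity and $(01)(23)$, $(02)(13)$, $(03)(12)$. *)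

theory Defs
  imports
    "HOL-Library.Numeral_Type"
    "HOL-Combinatorics.Perm"
    "HOL-Computational_Algebra.Polynomial"
begin

section \<open>Lie algebras and their modules\<close>

locale lie_algebra = vector_space scale
  for scale :: "'f::field \<Rightarrow> 'l::ab_group_add \<Rightarrow> 'l" +
  fixes bracket :: "'l \<Rightarrow> 'l \<Rightarrow> 'l"
  assumes bracket_add_left: "bracket (x + y) z = bracket x z + bracket y z"
    and bracket_add_right: "bracket x (y + z) = bracket x y + bracket x z"
    and bracket_scale_left: "bracket (scale a x) y = scale a (bracket x y)"
    and bracket_scale_right: "bracket x (scale a y) = scale a (bracket x y)"
    and bracket_self: "bracket x x = 0"
    and jacobi: "bracket x (bracket y z) + bracket y (bracket z x) + bracket z (bracket x y) = 0"

definition lie_algebra_hom ::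
  "('f::field \<Rightarrow> 'l::ab_group_add \<Rightarrow> 'l) \<Rightarrow> ('l \<Rightarrow> 'l \<Rightarrow> 'l) \<Rightarrow>
   ('f \<Rightarrow> 'm::ab_group_add \<Rightarrow> 'm) \<Rightarrow> ('m \<Rightarrow> 'm \<Rightarrow> 'm) \<Rightarrow> ('l \<Rightarrow> 'm) \<Rightarrow> bool"
  where "lie_algebra_hom scale bracket scale' bracket' h \<longleftrightarrow>
    Vector_Spaces.linear scale scale' h \<and> (\<forall>x y. h (bracket x y) = bracket' (h x) (h y))"

text \<open>The vector space underlying a module is the whole type \<open>'v\<close>, with scalar
  multiplication \<open>vscale\<close>; \<open>act \<xi> v\<close> is the vector \<open>\<xi>.v\<close>.\<close>

locale lie_module =
  L: lie_algebra scale bracket + V: vector_space vscale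
  for scale :: "'f::field \<Rightarrow> 'l::ab_group_add \<Rightarrow> 'l"
    and bracket :: "'l \<Rightarrow> 'l \<Rightarrow> 'l"
    and vscale :: "'f \<Rightarrow> 'v::ab_group_add \<Rightarrow> 'v" +
  fixes act :: "'l \<Rightarrow> 'v \<Rightarrow> 'v"
  assumes act_add_left: "act (x + y) v = act x v + act y v"
    and act_scale_left: "act (scale a x) v = vscale a (act x v)"
    and act_add_right: "act x (v + w) = act x v + act x w"
    and act_scale_right: "act x (vscale a v) = vscale a (act x v)"
    and act_bracket: "act (bracket x y) v = act x (act y v) - act y (act x v)"

definition finite_dimensional :: "('f::field \<Rightarrow> 'v::ab_group_add \<Rightarrow> 'v) \<Rightarrow> bool"
  where "finite_dimensional vscale \<longleftrightarrow> (\<exists>B. finite_dimensional_vector_space vscale B)"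

definition submodule ::
  "('f::field \<Rightarrow> 'v::ab_group_add \<Rightarrow> 'v) \<Rightarrow> ('l \<Rightarrow> 'v \<Rightarrow> 'v) \<Rightarrow> 'v set \<Rightarrow> bool"
  where "submodule vscale act W \<longleftrightarrow>
    module.subspace vscale W \<and> (\<forall>x. \<forall>w\<in>W. act x w \<in> W)"

definition irreducible_module ::
  "('f::field \<Rightarrow> 'v::ab_group_add \<Rightarrow> 'v) \<Rightarrow> ('l \<Rightarrow> 'v \<Rightarrow> 'v) \<Rightarrow> bool"
  where "irreducible_module vscale act \<longleftrightarrow>
    (UNIV :: 'v set) \<noteq> {0} \<and> (\<forall>W. submodule vscale act W \<longrightarrow> W = {0} \<or> W = UNIV)"

definition isomorphic_modules ::
  "('f::field \<Rightarrow> 'v::ab_group_add \<Rightarrow> 'v) \<Rightarrow> ('l \<Rightarrow> 'v \<Rightarrow> 'v) \<Rightarrow>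
   ('f \<Rightarrow> 'w::ab_group_add \<Rightarrow> 'w) \<Rightarrow> ('l \<Rightarrow> 'w \<Rightarrow> 'w) \<Rightarrow> bool"
  where "isomorphic_modules vscale act wscale act' \<longleftrightarrow>
    (\<exists>h. Vector_Spaces.linear vscale wscale h \<and> bij h \<and> (\<forall>x v. h (act x v) = act' x (h v)))"


section \<open>Lie algebras by generators and relations\<close>

datatype ('f, 'g) lie_term =
    Gen 'g
  | Zero
  | Add "('f, 'g) lie_term" "('f, 'g) lie_term"
  | Neg "('f, 'g) lie_term"
  | Scale 'f "('f, 'g) lie_term"
  | Bracket "('f, 'g) lie_term" "('f, 'g) lie_term"

text \<open>The least congruence on terms that contains the relations \<open>R\<close> and makes the quotient a
  Lie algebra. The quotient is the Lie algebra with generators \<open>'g\<close> and relations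
  \<open>s = t\<close> for \<open>R s t\<close>.\<close>

inductive lie_cong ::
  "(('f::field, 'g) lie_term \<Rightarrow> ('f, 'g) lie_term \<Rightarrow> bool) \<Rightarrow>
   ('f, 'g) lie_term \<Rightarrow> ('f, 'g) lie_term \<Rightarrow> bool"
  for R
  where
    rel: "R s t \<Longrightarrow> lie_cong R s t"
  | refl: "lie_cong R s s"
  | sym: "lie_cong R s t \<Longrightarrow> lie_cong R t s"
  | trans: "lie_cong R s t \<Longrightarrow> lie_cong R t u \<Longrightarrow> lie_cong R s u"
  | Add: "lie_cong R s s' \<Longrightarrow> lie_cong R t t' \<Longrightarrow> lie_cong R (Add s t) (Add s' t')"
  | Neg: "lie_cong R s s' \<Longrightarrow> lie_cong R (Neg s) (Neg s')"
  | Scale: "lie_cong R s s' \<Longrightarrow> lie_cong R (Scale a s) (Scale a s')"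
  | Bracket: "lie_cong R s s' \<Longrightarrow> lie_cong R t t' \<Longrightarrow> lie_cong R (Bracket s t) (Bracket s' t')"
  | add_assoc: "lie_cong R (Add (Add s t) u) (Add s (Add t u))"
  | add_commute: "lie_cong R (Add s t) (Add t s)"
  | add_zero: "lie_cong R (Add Zero s) s"
  | add_neg: "lie_cong R (Add (Neg s) s) Zero"
  | scale_add_right: "lie_cong R (Scale a (Add s t)) (Add (Scale a s) (Scale a t))"
  | scale_add_left: "lie_cong R (Scale (a + b) s) (Add (Scale a s) (Scale b s))"
  | scale_scale: "lie_cong R (Scale a (Scale b s)) (Scale (a * b) s)"
  | scale_one: "lie_cong R (Scale 1 s) s"
  | bracket_add_left: "lie_cong R (Bracket (Add s t) u) (Add (Bracket s u) (Bracket t u))"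
  | bracket_add_right: "lie_cong R (Bracket s (Add t u)) (Add (Bracket s t) (Bracket s u))"
  | bracket_scale_left: "lie_cong R (Bracket (Scale a s) t) (Scale a (Bracket s t))"
  | bracket_scale_right: "lie_cong R (Bracket s (Scale a t)) (Scale a (Bracket s t))"
  | bracket_self: "lie_cong R (Bracket s s) Zero"
  | jacobi: "lie_cong R (Add (Add (Bracket s (Bracket t u)) (Bracket t (Bracket u s)))
                             (Bracket u (Bracket s t))) Zero"

lemmas lie_cong_axioms = lie_cong.intros(9-)

lemma equivp_lie_cong: "equivp (lie_cong R)"
  by (intro equivpI reflpI sympI transpI)
    (erule (1) lie_cong.trans | erule lie_cong.sym | rule lie_cong.refl)+


section \<open>The tetrahedron algebra\<close>

text \<open>The index set \<open>{0, 1, 2, 3}\<close> is the numeral type \<open>4\<close>; its arithmetic modulo 4 plays no role.\<close>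

lemma UNIV_4: "(UNIV :: 4 set) = {0, 1, 2, 3}"
proof -
  have "card {0, 1, 2, 3 :: 4} = CARD(4)" by simp
  then show ?thesis by (metis card_subset_eq finite subset_UNIV)
qed

typedef tet_gen = "{(i, j). i \<noteq> (j :: 4)}"
  by (rule exI[of _ "(0, 1)"]) simp

setup_lifting type_definition_tet_gen

text \<open>The generator with indices \<open>i\<close>, \<open>j\<close>; only meaningful for \<open>i \<noteq> j\<close>.\<close>

definition tet_gen :: "4 \<Rightarrow> 4 \<Rightarrow> tet_gen"
  where "tet_gen i j = Abs_tet_gen (i, j)"

abbreviation GenX :: "4 \<Rightarrow> 4 \<Rightarrow> ('f, tet_gen) lie_term"
  where "GenX i j \<equiv> Gen (tet_gen i j)"

inductive tet_rel :: "('f::field, tet_gen) lie_term \<Rightarrow> ('f, tet_gen) lie_term \<Rightarrow> bool"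
  where
    tet_rel1: "i \<noteq> j \<Longrightarrow> tet_rel (Add (GenX i j) (GenX j i)) Zero"
  | tet_rel2: "distinct [i, j, k] \<Longrightarrow>
      tet_rel (Bracket (GenX i j) (GenX j k)) (Add (Scale 2 (GenX i j)) (Scale 2 (GenX j k)))"
  | tet_rel3: "distinct [i, j, k, l] \<Longrightarrow>
      tet_rel (Bracket (GenX i j) (Bracket (GenX i j) (Bracket (GenX i j) (GenX k l))))
              (Scale 4 (Bracket (GenX i j) (GenX k l)))"

quotient_type (overloaded) 'f tet = "('f::field, tet_gen) lie_term" / "lie_cong tet_rel"
  by (rule equivp_lie_cong)

instantiation tet :: (field) ab_group_add
begin

lift_definition zero_tet :: "'a tet" is Zero .
lift_definition plus_tet :: "'a tet \<Rightarrow> 'a tet \<Rightarrow> 'a tet" is Add by (rule lie_cong.Add)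
lift_definition uminus_tet :: "'a tet \<Rightarrow> 'a tet" is Neg by (rule lie_cong.Neg)
definition minus_tet :: "'a tet \<Rightarrow> 'a tet \<Rightarrow> 'a tet" where "minus_tet x y = x + - y"

instance
proof
  fix a b c :: "'a tet"
  show "a + b + c = a + (b + c)" by transfer (rule lie_cong.add_assoc)
  show "a + b = b + a" by transfer (rule lie_cong.add_commute)
  show "0 + a = a" by transfer (rule lie_cong.add_zero)
  show "- a + a = 0" by transfer (rule lie_cong.add_neg)
  show "a - b = a + - b" by (rule minus_tet_def)
qed

end

lift_definition tet_scale :: "'f::field \<Rightarrow> 'f tet \<Rightarrow> 'f tet" is Scale by (rule lie_cong.Scale)

lift_definition tet_bracket :: "'f::field tet \<Rightarrow> 'f tet \<Rightarrow> 'f tet" is Bracket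
  by (rule lie_cong.Bracket)

lift_definition tet_x :: "4 \<Rightarrow> 4 \<Rightarrow> 'f::field tet" is GenX .

interpretation tet: lie_algebra "tet_scale :: 'f::field \<Rightarrow> 'f tet \<Rightarrow> 'f tet" tet_bracket
  by standard (transfer, rule lie_cong_axioms)+

lemma tet_relations:
  "i \<noteq> j \<Longrightarrow> tet_x i j + tet_x j i = (0 :: 'f::field tet)"
  "distinct [i, j, k] \<Longrightarrow>
     tet_bracket (tet_x i j) (tet_x j k) = tet_scale 2 (tet_x i j) + tet_scale 2 (tet_x j k :: 'f tet)"
  "distinct [i, j, k, l] \<Longrightarrow>
     tet_bracket (tet_x i j) (tet_bracket (tet_x i j) (tet_bracket (tet_x i j) (tet_x k l))) =
     tet_scale 4 (tet_bracket (tet_x i j) (tet_x k l :: 'f tet))"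
  by (transfer, rule lie_cong.rel, rule tet_rel.intros, assumption)+


section \<open>The universal property\<close>

lemma tet_gen_cases: obtains i j where "i \<noteq> j" "g = tet_gen i j"
  by (metis (mono_tags, lifting) Abs_tet_gen_cases case_prodE mem_Collect_eq tet_gen_def)

lemma tet_gen_inject: "i \<noteq> j \<Longrightarrow> k \<noteq> l \<Longrightarrow> tet_gen i j = tet_gen k l \<longleftrightarrow> i = k \<and> j = l"
  by (simp add: tet_gen_def Abs_tet_gen_inject)

lemma tet_induct [case_names gen zero add neg scale bracket]:
  assumes "\<And>i j. i \<noteq> j \<Longrightarrow> P (tet_x i j)" "P 0" "\<And>u v. P u \<Longrightarrow> P v \<Longrightarrow> P (u + v)"
    "\<And>u. P u \<Longrightarrow> P (- u)" "\<And>a u. P u \<Longrightarrow> P (tet_scale a u)"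
    "\<And>u v. P u \<Longrightarrow> P v \<Longrightarrow> P (tet_bracket u v)"
  shows "P (u :: 'f::field tet)"
proof -
  have "P (abs_tet t)" for t
  proof (induction t)
    case (Gen g)
    then show ?case using assms(1) by (metis tet_gen_cases tet_x.abs_eq)
  qed (use assms(2-) in \<open>simp_all add: zero_tet.abs_eq plus_tet.abs_eq [symmetric]
    uminus_tet.abs_eq [symmetric] tet_scale.abs_eq [symmetric] tet_bracket.abs_eq [symmetric]
    flip: zero_tet.abs_eq\<close>)
  then show ?thesis by (metis Quotient_tet Quotient_def)
qed

context lie_algebra
begin

primrec lie_eval :: "('g \<Rightarrow> 'l) \<Rightarrow> ('f, 'g) lie_term \<Rightarrow> 'l"
  where
    "lie_eval e (Gen g) = e g"
  | "lie_eval e Zero = 0"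
  | "lie_eval e (Add s t) = lie_eval e s + lie_eval e t"
  | "lie_eval e (Neg s) = - lie_eval e s"
  | "lie_eval e (Scale a s) = scale a (lie_eval e s)"
  | "lie_eval e (Bracket s t) = bracket (lie_eval e s) (lie_eval e t)"

lemma lie_eval_cong:
  assumes "lie_cong R s t" and "\<And>s t. R s t \<Longrightarrow> lie_eval e s = lie_eval e t"
  shows "lie_eval e s = lie_eval e t"
  using assms(1)
  by induction
    (simp_all add: assms(2) bracket_add_left bracket_add_right bracket_scale_left
      bracket_scale_right bracket_self jacobi [unfolded add.assoc] algebra_simps)

theorem tet_universal:
  fixes y :: "4 \<Rightarrow> 4 \<Rightarrow> 'l"
  assumes "\<And>i j. i \<noteq> j \<Longrightarrow> y i j + y j i = 0"
    and "\<And>i j k. distinct [i, j, k] \<Longrightarrow>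
      bracket (y i j) (y j k) = scale 2 (y i j) + scale 2 (y j k)"
    and "\<And>i j k l. distinct [i, j, k, l] \<Longrightarrow>
      bracket (y i j) (bracket (y i j) (bracket (y i j) (y k l))) =
      scale 4 (bracket (y i j) (y k l))"
  shows "\<exists>!h. lie_algebra_hom tet_scale tet_bracket scale bracket h \<and>
    (\<forall>i j. i \<noteq> j \<longrightarrow> h (tet_x i j) = y i j)"
proof (rule ex_ex1I)
  define e where "e g = (case Rep_tet_gen g of (i, j) \<Rightarrow> y i j)" for g
  have e: "e (tet_gen i j) = y i j" if "i \<noteq> j" for i j
    using that by (simp add: e_def tet_gen_def Abs_tet_gen_inverse)
  have R: "lie_eval e s = lie_eval e t" if "tet_rel s t" for s t
    using that by cases (use assms e in \<open>auto\<close>)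
  define h where "h u = lie_eval e (rep_tet u)" for u
  have h: "h (abs_tet t) = lie_eval e t" for t
    unfolding h_def
    by (rule lie_eval_cong[OF _ R]) (use Quotient3_tet in \<open>auto intro: rep_abs_rsp_left lie_cong.refl\<close>)
  have surj: "\<exists>t. u = abs_tet t" for u by (metis Quotient_tet Quotient_def)
  have "h (u + v) = h u + h v" "h (tet_scale a u) = scale a (h u)"
    "h (tet_bracket u v) = bracket (h u) (h v)" for u v a
    using surj[of u] surj[of v]
    by (auto simp: plus_tet.abs_eq tet_scale.abs_eq tet_bracket.abs_eq h)
  then have "lie_algebra_hom tet_scale tet_bracket scale bracket h"
    by (simp add: lie_algebra_hom_def Vector_Spaces.linear_iff tet.vector_space_axioms
        vector_space_axioms)
  moreover have "h (tet_x i j) = y i j" if "i \<noteq> j" for i j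
    using that by (simp add: tet_x.abs_eq h e)
  ultimately show "\<exists>h. lie_algebra_hom tet_scale tet_bracket scale bracket h \<and>
    (\<forall>i j. i \<noteq> j \<longrightarrow> h (tet_x i j) = y i j)" by blast
next
  fix h h'
  assume *: "lie_algebra_hom tet_scale tet_bracket scale bracket h \<and>
      (\<forall>i j. i \<noteq> j \<longrightarrow> h (tet_x i j) = y i j)"
    "lie_algebra_hom tet_scale tet_bracket scale bracket h' \<and>
      (\<forall>i j. i \<noteq> j \<longrightarrow> h' (tet_x i j) = y i j)"
  interpret h: Vector_Spaces.linear tet_scale scale h using * by (simp add: lie_algebra_hom_def)
  interpret h': Vector_Spaces.linear tet_scale scale h' using * by (simp add: lie_algebra_hom_def)
  have "h u = h' u" for u
    by (induction u rule: tet_induct)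
      (use * in \<open>auto simp: lie_algebra_hom_def h.add h'.add h.neg h'.neg h.scale h'.scale\<close>)
  then show "h = h'" by blast
qed

end


section \<open>The action of the symmetric group and twisting\<close>

lift_definition perm_gen :: "4 perm \<Rightarrow> tet_gen \<Rightarrow> tet_gen"
  is "\<lambda>\<sigma> (i, j). (Perm.apply \<sigma> i, Perm.apply \<sigma> j)"
  by (auto simp: apply_inj)

lemma perm_gen_tet_gen:
  "i \<noteq> j \<Longrightarrow> perm_gen \<sigma> (tet_gen i j) = tet_gen (Perm.apply \<sigma> i) (Perm.apply \<sigma> j)"
  by (simp add: perm_gen_def tet_gen_def Abs_tet_gen_inverse)

lemma tet_rel_perm:
  "tet_rel s t \<Longrightarrow> tet_rel (map_lie_term id (perm_gen \<sigma>) s) (map_lie_term id (perm_gen \<sigma>) t)"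
  by (induction rule: tet_rel.induct) (auto simp: perm_gen_tet_gen apply_inj intro!: tet_rel.intros)

lift_definition perm_tet :: "4 perm \<Rightarrow> 'f::field tet \<Rightarrow> 'f tet"
  is "\<lambda>\<sigma>. map_lie_term id (perm_gen \<sigma>)"
proof -
  fix \<sigma> and s t :: "('f, tet_gen) lie_term"
  assume "lie_cong tet_rel s t"
  then show "lie_cong tet_rel (map_lie_term id (perm_gen \<sigma>) s) (map_lie_term id (perm_gen \<sigma>) t)"
  proof induction
    case (rel s t)
    then show ?case by (intro lie_cong.rel tet_rel_perm)
  next
    case (trans s t u)
    then show ?case by (blast intro: lie_cong.trans)
  qed (simp_all add: lie_cong.intros(2-3,5-))
qed

lemma perm_tet_gen:
  "i \<noteq> j \<Longrightarrow> perm_tet \<sigma> (tet_x i j) = tet_x (Perm.apply \<sigma> i) (Perm.apply \<sigma> j)"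
  by (simp add: perm_tet.abs_eq tet_x.abs_eq perm_gen_tet_gen)

lemma perm_tet_hom: "lie_algebra_hom tet_scale tet_bracket tet_scale tet_bracket (perm_tet \<sigma>)"
proof -
  have "perm_tet \<sigma> (u + v) = perm_tet \<sigma> u + perm_tet \<sigma> v"
    "perm_tet \<sigma> (tet_scale a u) = tet_scale a (perm_tet \<sigma> u)"
    "perm_tet \<sigma> (tet_bracket u v) = tet_bracket (perm_tet \<sigma> u) (perm_tet \<sigma> v)" for u v and a :: 'a
    by (transfer, simp add: lie_cong.refl)+
  then show ?thesis
    by (simp add: lie_algebra_hom_def Vector_Spaces.linear_iff tet.vector_space_axioms)
qed

lemma perm_tet_simps [simp]:
  "perm_tet \<sigma> 0 = 0"
  "perm_tet \<sigma> (u + v) = perm_tet \<sigma> u + perm_tet \<sigma> v"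
  "perm_tet \<sigma> (- u) = - perm_tet \<sigma> u"
  "perm_tet \<sigma> (tet_scale a u) = tet_scale a (perm_tet \<sigma> u)"
  "perm_tet \<sigma> (tet_bracket u v) = tet_bracket (perm_tet \<sigma> u) (perm_tet \<sigma> v)"
  by (transfer, simp add: lie_cong.refl)+

lemma perm_tet_one: "perm_tet 1 u = u"
  by (induction u rule: tet_induct) (simp_all add: perm_tet_gen)

lemma perm_tet_times: "perm_tet (\<sigma> * \<tau>) u = perm_tet \<sigma> (perm_tet \<tau> u)"
  by (induction u rule: tet_induct) (simp_all add: perm_tet_gen apply_inj apply_times)

definition twist :: "4 perm \<Rightarrow> ('f::field tet \<Rightarrow> 'v \<Rightarrow> 'v) \<Rightarrow> 'f tet \<Rightarrow> 'v \<Rightarrow> 'v"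
  where "twist \<sigma> act \<xi> = act (perm_tet (inverse \<sigma>) \<xi>)"

abbreviation tet_module :: "('f::field \<Rightarrow> 'v::ab_group_add \<Rightarrow> 'v) \<Rightarrow> ('f tet \<Rightarrow> 'v \<Rightarrow> 'v) \<Rightarrow> bool"
  where "tet_module \<equiv> lie_module tet_scale tet_bracket"

lemma tet_module_twist:
  assumes "tet_module vscale act"
  shows "tet_module vscale (twist \<sigma> act)"
proof -
  interpret lie_module tet_scale tet_bracket vscale act by fact
  show ?thesis
    by standard (simp_all add: twist_def act_add_left act_add_right act_scale_left
        act_scale_right act_bracket)
qed

context
  includes permutation_syntax
begin

definition klein_four :: "4 perm set"
  where "klein_four = {1, \<langle>0 \<leftrightarrow> 1\<rangle> * \<langle>2 \<leftrightarrow> 3\<rangle>, \<langle>0 \<leftrightarrow> 2\<rangle> * \<langle>1 \<leftrightarrow> 3\<rangle>, \<langle>0 \<leftrightarrow> 3\<rangle> * \<langle>1 \<leftrightarrow> 2\<rangle>}"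

end

end

theory Submission
  imports Defs "HOL-Library.Function_Algebras" "HOL-Analysis.Product_Vector"
begin

text \<open>Proof idea. Inside \<open>\<boxtimes>\<close> we find the current algebra \<open>sl\<^sub>2 \<otimes> F[t]\<close> with basis
  \<open>E k = e t\<^sup>k\<close>, \<open>H k = h t\<^sup>k\<close>, \<open>F k = f t\<^sup>k\<close>, where \<open>2 h = x\<^sub>1\<^sub>2\<close>, and two further elements that act
  on it like \<open>e / (1 - t)\<close> and \<open>f / t\<close>. On a finite-dimensional module these are combinations of the
  \<open>E k\<close> and of the \<open>F k\<close>, so that highest weight theory applies: an irreducible module is determined
  by the eigenvalues \<open>\<mu> k\<close> of the \<open>H k\<close> on a highest weight vector. If \<open>a\<close> is one, then
  \<open>f\<^sup>d a\<close> with \<open>d\<close> maximal is a lowest weight vector, on which \<open>H k\<close> has the eigenvalue \<open>- \<mu> k\<close>. The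
  permutation \<open>(12)(03)\<close> exchanges raising and lowering elements and maps \<open>H k\<close> to \<open>- H k\<close>, so this
  lowest weight vector is a highest weight vector of the twisted module, with the same eigenvalues
  \<open>\<mu> k\<close>. The other elements of \<open>G\<close> are obtained by renaming the indices.\<close>

section \<open>Linear algebra\<close>

text \<open>The realisation of \<boxtimes> over F[t, 1/t, 1/(1 - t)] only suggests which elements to
  define; every identity is derived from the defining relations. The obstacle is that these are
  finitely many, whereas highest weight theory needs the brackets of \<open>E i\<close>,
  \<open>F j\<close> and \<open>H k\<close> in all degrees. They follow by induction on the degree
  in t from relations of degree at most 3. That the eigenvalues \<mu> k determine the module is
  shown without Verma modules. In the direct sum of the twisted and the original module, the pair
  (w, v) of highest weight vectors generates a submodule in which the vectors of weight \<mu> 0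
  under \<open>h\<close> form a line. So it contains neither (w, 0) nor (0, v), and irreducibility
  makes it the graph of an isomorphism. The permutation (12)(03) negates every \<open>H k\<close>,
  and not only \<open>h\<close>, because in the realisation it fixes t.\<close>

context vector_space
begin

text \<open>Take the least \<open>n\<close> with \<open>T n\<close> in the span of its predecessors.
  All earlier terms avoid the span of theirs, so they are independent as an indexed family, without
  repetitions. The relation obtained serves as a minimal polynomial.\<close>

lemma first_dependent:
  fixes T :: "nat \<Rightarrow> 'b"
  assumes "finite X" and T: "\<And>k. T k \<in> span X"
  obtains n c where "T n = (\<Sum>k<n. c k *s T k)"
    and "\<And>d. (\<Sum>k<n. d k *s T k) = 0 \<Longrightarrow> (\<forall>k<n. d k = 0)"
proof -
  define P where "P n \<longleftrightarrow> T n \<in> span (T ` {..<n})" for n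
  have indep: "independent (T ` {..<n}) \<and> inj_on T {..<n}" if "\<forall>k<n. \<not> P k" for n
    using that
  proof (induction n)
    case (Suc n)
    then have ih: "independent (T ` {..<n})" "inj_on T {..<n}" and "\<not> P n"
      using less_Suc_eq by auto
    have notin: "T n \<notin> span (T ` {..<n})" using \<open>\<not> P n\<close> unfolding P_def .
    then have "independent (insert (T n) (T ` {..<n}))"
      by (intro independent_insertI ih)
    moreover have "T n \<notin> T ` {..<n}" using notin span_base[of "T n"] by metis
    ultimately show ?case using ih by (simp add: lessThan_Suc)
  qed (simp add: independent_empty)
  have "\<exists>n. P n"
  proof (rule ccontr)
    assume "\<nexists>n. P n"
    then have ind: "independent (T ` {..<Suc (card X)})" and inj: "inj_on T {..<Suc (card X)}"
      using indep by blast+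
    have "card (T ` {..<Suc (card X)}) \<le> card X"
      using independent_span_bound[OF \<open>finite X\<close> ind] T by blast
    then show False unfolding card_image[OF inj] by simp
  qed
  define n where "n = (LEAST n. P n)"
  have "P n" unfolding n_def using \<open>\<exists>n. P n\<close> by (rule LeastI_ex)
  have ind: "independent (T ` {..<n})" and inj: "inj_on T {..<n}"
    using indep[of n] not_less_Least[of _ P] unfolding n_def by blast+
  obtain u where "T n = (\<Sum>a\<in>T ` {..<n}. u a *s a)"
    using \<open>P n\<close> unfolding P_def span_finite[OF finite_imageI[OF finite_lessThan]] by blast
  then have "T n = (\<Sum>k<n. u (T k) *s T k)" by (simp add: sum.reindex[OF inj])
  moreover have "\<forall>k<n. d k = 0" if "(\<Sum>k<n. d k *s T k) = 0" for d
  proof (intro allI impI)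
    fix k assume "k < n"
    let ?u = "d \<circ> the_inv_into {..<n} T"
    have "(\<Sum>a\<in>T ` {..<n}. ?u a *s a) = (\<Sum>k<n. d k *s T k)"
      by (simp add: sum.reindex[OF inj] the_inv_into_f_f[OF inj])
    then have "?u (T k) = 0"
      using independentD[OF ind, of "T ` {..<n}" ?u "T k"] that \<open>k < n\<close> by simp
    then show "d k = 0" using \<open>k < n\<close> by (simp add: the_inv_into_f_f[OF inj])
  qed
  ultimately show thesis by (rule that)
qed

text \<open>Division of the polynomial q(t) by t - a with remainder q(a). The powers of t are
  replaced by an arbitrary sequence \<open>x\<close>, on which the quotient coefficients
  \<open>r\<close> do not depend, so that it applies to iterates of a linear map.\<close>

lemma synthetic_division:
  "\<exists>r. (0 < n \<longrightarrow> r (n - 1) = q n) \<and>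
     (\<forall>x. (\<Sum>j<n. r j *s (x (Suc j) - a *s x j)) =
       (\<Sum>k\<le>n. q k *s x k) - (\<Sum>k\<le>n. q k * a ^ k) *s x 0)"
proof (induction n arbitrary: q)
  case (Suc n)
  \<comment> \<open>The top term t^(n+1) is split as (t - a) t^n + a t^n; its second part joins the
    coefficient of degree n.\<close>
  define q' where "q' = q(n := q n + a * q (Suc n))"
  obtain r where r: "\<And>x. (\<Sum>j<n. r j *s (x (Suc j) - a *s x j)) =
       (\<Sum>k\<le>n. q' k *s x k) - (\<Sum>k\<le>n. q' k * a ^ k) *s x 0"
    using Suc[of q'] by blast
  have 1: "(\<Sum>k\<le>n. q' k *s x k) = (\<Sum>k\<le>n. q k *s x k) + (a * q (Suc n)) *s x n" for x
  proof (cases n)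
    case (Suc m)
    have "(\<Sum>k\<le>m. q' k *s x k) = (\<Sum>k\<le>m. q k *s x k)"
      by (rule sum.cong) (auto simp: q'_def Suc)
    then show ?thesis by (simp add: Suc) (simp add: q'_def Suc scale_left_distrib)
  qed (simp add: q'_def scale_left_distrib)
  have 2: "(\<Sum>k\<le>n. q' k * a ^ k) = (\<Sum>k\<le>n. q k * a ^ k) + (a * q (Suc n)) * a ^ n"
  proof (cases n)
    case (Suc m)
    have "(\<Sum>k\<le>m. q' k * a ^ k) = (\<Sum>k\<le>m. q k * a ^ k)"
      by (rule sum.cong) (auto simp: q'_def Suc)
    then show ?thesis by (simp add: Suc) (simp add: q'_def Suc algebra_simps)
  qed (simp add: q'_def algebra_simps)
  let ?r = "r(n := q (Suc n))"
  have "(\<Sum>j<Suc n. ?r j *s (x (Suc j) - a *s x j)) =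
       (\<Sum>k\<le>Suc n. q k *s x k) - (\<Sum>k\<le>Suc n. q k * a ^ k) *s x 0" for x
  proof -
    have "(\<Sum>j<n. ?r j *s (x (Suc j) - a *s x j)) = (\<Sum>j<n. r j *s (x (Suc j) - a *s x j))"
      by (rule sum.cong) auto
    then show ?thesis by (simp add: r 1 2) (simp add: algebra_simps)
  qed
  then show ?case by (intro exI[of _ ?r]) auto
qed simp

text \<open>Applying T - \<mu> j removes the summand \<open>s j\<close> and multiplies each other
  one by the nonzero number \<mu> i - \<mu> j, which leaves a smaller index set. This form, which
  allows zero summands, separates weight components.\<close>

lemma eigenvectors_sum_zero:
  assumes T: "Vector_Spaces.linear scale scale T"
    and "finite I" "inj_on \<mu> I" "\<And>i. i \<in> I \<Longrightarrow> T (s i) = \<mu> i *s s i" "sum s I = 0" "i \<in> I"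
  shows "s i = 0"
  using assms(2-)
proof (induction I arbitrary: s i)
  case (insert j I)
  interpret T: Vector_Spaces.linear scale scale T by fact
  let ?s = "\<lambda>i. (\<mu> i - \<mu> j) *s s i"
  have "0 = T (sum s (insert j I)) - \<mu> j *s sum s (insert j I)"
    using insert.prems(3) by (simp add: T.zero)
  also have "\<dots> = (\<Sum>i\<in>insert j I. T (s i) - \<mu> j *s s i)"
    by (simp add: T.sum scale_sum_right sum_subtractf del: sum.insert)
  also have "\<dots> = (\<Sum>i\<in>insert j I. ?s i)"
    by (rule sum.cong) (auto simp: insert.prems(2) scale_left_diff_distrib)
  also have "\<dots> = sum ?s I" using insert.hyps by simp
  finally have "sum ?s I = 0" ..
  then have "?s i = 0" if "i \<in> I" for i
    using insert.IH[of ?s i] insert.prems that by (auto simp: T.scale mult.commute)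
  moreover have "\<mu> i \<noteq> \<mu> j" if "i \<in> I" for i
    using that inj_on_eq_iff[OF insert.prems(1), of i j] insert.hyps by auto
  ultimately have zero: "s i = 0" if "i \<in> I" for i using that by simp
  then have "s j = 0" using insert.prems(3) insert.hyps by simp
  then show ?case using zero insert.prems(4) by auto
qed auto

lemma eigenvector_sequence_has_zero:
  fixes s :: "nat \<Rightarrow> 'b"
  assumes T: "Vector_Spaces.linear scale scale T" and "finite X" "\<And>k. s k \<in> span X"
    and "inj \<mu>" and s: "\<And>k. T (s k) = \<mu> k *s s k"
  obtains k where "s k = 0"
proof -
  interpret T: Vector_Spaces.linear scale scale T by fact
  obtain n c where n: "s n = (\<Sum>k<n. c k *s s k)"
    using first_dependent[of X s] assms by metis
  define t where "t k = (if k = n then s k else - (c k *s s k))" for k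
  have "sum t {..<n} = (\<Sum>k<n. - (c k *s s k))" by (rule sum.cong) (auto simp: t_def)
  then have "sum t {..n} = 0"
    by (simp add: lessThan_Suc_atMost[symmetric] n sum_negf t_def)
  moreover have "T (t k) = \<mu> k *s t k" for k
    by (simp add: t_def s T.neg T.scale mult.commute)
  ultimately have "t n = 0"
    using eigenvectors_sum_zero[OF T, of "{..n}" \<mu> t n] \<open>inj \<mu>\<close> by (auto intro: inj_on_subset)
  then show thesis using that[of n] by (simp add: t_def)
qed

end

text \<open>Let \<open>q\<close> be the minimal relation among the iterates of \<open>T\<close> on
  \<open>v\<close>. If a is a root, q(t) = (t - a) r(t), and w = r(T) v satisfies T w = a w; it is
  nonzero because r has smaller degree than the minimal relation.\<close>

lemma eigenvector_exists:
  fixes scale :: "'f::alg_closed_field \<Rightarrow> 'v::ab_group_add \<Rightarrow> 'v"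
  assumes T: "Vector_Spaces.linear scale scale T" and "finite X" "U \<subseteq> module.span scale X"
    and U: "module.subspace scale U" "\<And>x. x \<in> U \<Longrightarrow> T x \<in> U"
    and "v \<in> U" "v \<noteq> 0"
  obtains a w where "w \<in> U" "w \<noteq> 0" "T w = scale a w"
proof -
  interpret T: Vector_Spaces.linear scale scale T by fact
  define x where "x k = (T ^^ k) v" for k
  have xU: "x k \<in> U" for k by (induction k) (simp_all add: x_def U \<open>v \<in> U\<close>)
  then have xX: "x k \<in> module.span scale X" for k using assms(3) by auto
  obtain n c where n: "x n = (\<Sum>k<n. scale (c k) (x k))"
    and indep: "\<And>d. (\<Sum>k<n. scale (d k) (x k)) = 0 \<Longrightarrow> (\<forall>k<n. d k = 0)"
    by (rule T.vs1.first_dependent[OF assms(2), of x, OF xX]) blast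
  define q where "q k = (if k = n then 1 else - c k)" for k
  have "(\<Sum>k<n. scale (q k) (x k)) = (\<Sum>k<n. - scale (c k) (x k))"
    by (rule sum.cong) (auto simp: q_def)
  then have q: "(\<Sum>k\<le>n. scale (q k) (x k)) = 0"
    by (simp add: lessThan_Suc_atMost[symmetric] sum_negf n) (simp add: q_def n)
  have "0 < n" using n \<open>v \<noteq> 0\<close> by (cases n) (auto simp: x_def)
  then obtain a where a: "(\<Sum>k\<le>n. q k * a ^ k) = 0"
    using alg_closed[of n q] by (auto simp: q_def)
  obtain r where r: "r (n - 1) = q n" and div: "\<And>x. (\<Sum>j<n. scale (r j) (x (Suc j) - scale a (x j))) =
       (\<Sum>k\<le>n. scale (q k) (x k)) - scale (\<Sum>k\<le>n. q k * a ^ k) (x 0)"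
    using T.vs1.synthetic_division[of n q a] \<open>0 < n\<close> by auto
  define w where "w = (\<Sum>j<n. scale (r j) (x j))"
  have "(\<Sum>j<n. scale (r j) (x (Suc j) - scale a (x j))) = 0"
    unfolding div q a by simp
  then have "T w - scale a w = 0"
    by (simp add: w_def T.sum T.scale x_def T.vs1.scale_right_diff_distrib sum_subtractf
        T.vs1.scale_sum_right mult.commute)
  moreover have "w \<noteq> 0"
  proof
    assume "w = 0"
    then have "r (n - 1) = 0" using indep[of r] \<open>0 < n\<close> by (simp add: w_def)
    then show False using r by (simp add: q_def)
  qed
  moreover have "w \<in> U"
    unfolding w_def by (intro T.vs1.subspace_sum T.vs1.subspace_scale U xU)
  ultimately show thesis using that[of w a] by simp
qed

lemma vector_space_fun:
  fixes scale :: "'f::field \<Rightarrow> 'v::ab_group_add \<Rightarrow> 'v"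
  assumes "vector_space scale"
  shows "vector_space (\<lambda>c (T :: 'a \<Rightarrow> 'v) x. scale c (T x))"
proof -
  interpret vector_space scale by fact
  show ?thesis by standard (auto simp: fun_eq_iff scale_right_distrib scale_left_distrib)
qed

lemma sum_fun_apply: "sum f A x = (\<Sum>a\<in>A. f a x)"
  for f :: "'a \<Rightarrow> 'b \<Rightarrow> 'c::comm_monoid_add"
  by (induction A rule: infinite_finite_induct) simp_all

text \<open>The spanning set consists of the matrix units \<open>D (b, b')\<close>. It is what
  forces a linear relation among infinitely many operators of a module.\<close>

lemma (in finite_dimensional_vector_space) linear_maps_finite_span:
  obtains X :: "('b \<Rightarrow> 'b) set" where "finite X"
    and "\<And>T. Vector_Spaces.linear scale scale T \<Longrightarrow> T \<in> module.span (\<lambda>c T x. c *s T x) X"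
proof -
  interpret F: vector_space "\<lambda>c (T :: 'b \<Rightarrow> 'b) x. c *s T x"
    by (rule vector_space_fun) (rule vector_space_axioms)
  define R where "R = representation Basis"
  have R: "(\<Sum>b\<in>Basis. R v b *s b) = v" for v
    unfolding R_def
    by (rule sum_representation_eq) (simp_all add: independent_Basis span_Basis finite_Basis)
  define D where "D = (\<lambda>(b, b') x. R x b *s b')"
  have fin: "finite (D ` (Basis \<times> Basis))" by (simp add: finite_Basis)
  have "T \<in> F.span (D ` (Basis \<times> Basis))" if "Vector_Spaces.linear scale scale T" for T
  proof -
    interpret T: Vector_Spaces.linear scale scale T by fact
    have eq: "T x = (\<Sum>b\<in>Basis. \<Sum>b'\<in>Basis. R (T b) b' *s D (b, b') x)" for x
    proof -
      have "T (\<Sum>b\<in>Basis. R x b *s b) = (\<Sum>b\<in>Basis. R x b *s T b)"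
        by (simp add: T.sum T.scale)
      then have "T x = (\<Sum>b\<in>Basis. R x b *s T b)" by (simp only: R)
      also have "\<dots> = (\<Sum>b\<in>Basis. R x b *s (\<Sum>b'\<in>Basis. R (T b) b' *s b'))"
        by (simp add: R)
      finally show ?thesis by (simp add: D_def scale_sum_right mult.commute)
    qed
    have "T = (\<Sum>b\<in>Basis. \<Sum>b'\<in>Basis. (\<lambda>x. R (T b) b' *s D (b, b') x))"
      unfolding fun_eq_iff sum_fun_apply by (intro allI eq)
    also have "\<dots> \<in> F.span (D ` (Basis \<times> Basis))"
      by (intro F.span_sum F.span_scale F.span_base) auto
    finally show ?thesis .
  qed
  then show thesis using fin that by blast
qed

section \<open>The current algebra of \<open>sl\<^sub>2\<close>\<close>

context lie_algebra
begin

notation bracket ("\<langle>_,/ _\<rangle>")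

lemma linear_bracket: "Vector_Spaces.linear scale scale (bracket x)"
  by (simp add: Vector_Spaces.linear_iff vector_space_axioms bracket_add_right bracket_scale_right)

lemma bracket_zero_right [simp]: "\<langle>x, 0\<rangle> = 0"
  using bracket_scale_right[of x 0 0] by simp

lemma bracket_zero_left [simp]: "\<langle>0, x\<rangle> = 0"
  using bracket_scale_left[of 0 0 x] by simp

lemma bracket_minus_right [simp]: "\<langle>x, - y\<rangle> = - \<langle>x, y\<rangle>"
proof -
  have "\<langle>x, y\<rangle> + \<langle>x, - y\<rangle> = 0" by (simp flip: bracket_add_right)
  then show ?thesis by (rule minus_unique[symmetric])
qed

lemma bracket_minus_left [simp]: "\<langle>- x, y\<rangle> = - \<langle>x, y\<rangle>"
proof -
  have "\<langle>x, y\<rangle> + \<langle>- x, y\<rangle> = 0" by (simp flip: bracket_add_left)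
  then show ?thesis by (rule minus_unique[symmetric])
qed

lemma bracket_diff_right: "\<langle>x, y - z\<rangle> = \<langle>x, y\<rangle> - \<langle>x, z\<rangle>"
  using bracket_add_right[of x y "- z"] by simp

lemma bracket_diff_left: "\<langle>x - y, z\<rangle> = \<langle>x, z\<rangle> - \<langle>y, z\<rangle>"
  using bracket_add_left[of x "- y" z] by simp

lemma bracket_anticommute: "\<langle>x, y\<rangle> = - \<langle>y, x\<rangle>"
proof -
  have "\<langle>x + y, x + y\<rangle> = \<langle>y, x\<rangle> + \<langle>x, y\<rangle>"
    unfolding bracket_add_left bracket_add_right by (simp add: bracket_self)
  then have "\<langle>y, x\<rangle> + \<langle>x, y\<rangle> = 0" by (simp add: bracket_self)
  then show ?thesis by (rule minus_unique[symmetric])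
qed

lemma jacobi_right: "\<langle>x, \<langle>y, z\<rangle>\<rangle> = \<langle>\<langle>x, y\<rangle>, z\<rangle> + \<langle>y, \<langle>x, z\<rangle>\<rangle>"
  using jacobi[of x y z] bracket_anticommute[of z x] bracket_anticommute[of z "\<langle>x, y\<rangle>"]
  by (simp add: algebra_simps)

lemma jacobi_left: "\<langle>\<langle>x, y\<rangle>, z\<rangle> = \<langle>x, \<langle>y, z\<rangle>\<rangle> - \<langle>y, \<langle>x, z\<rangle>\<rangle>"
  using jacobi_right[of x y z] by simp

end

text \<open>Here \<open>h1\<close> plays the role of t h. Besides sl2 itself, only a few relations
  of degree at most 3 are assumed: t e commutes with e and with t^2 e, likewise for f, and
  \<open>h1\<close> is compatible with \<open>h\<close>, \<open>e\<close> and \<open>f\<close>. They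
  turn out to force all brackets of the current algebra.\<close>

locale current_algebra = lie_algebra scale bracket
  for scale :: "'f::field_char_0 \<Rightarrow> 'l::ab_group_add \<Rightarrow> 'l" and bracket +
  fixes e f h h1 :: 'l
  assumes h_e: "\<langle>h, e\<rangle> = e" and h_f: "\<langle>h, f\<rangle> = - f" and e_f: "\<langle>e, f\<rangle> = h"
    and h_h1: "\<langle>h, h1\<rangle> = 0" and e1_f: "\<langle>\<langle>h1, e\<rangle>, f\<rangle> = h1"
    and e_e1: "\<langle>e, \<langle>h1, e\<rangle>\<rangle> = 0" and f_f1: "\<langle>f, \<langle>h1, f\<rangle>\<rangle> = 0"
    and e1_e2: "\<langle>\<langle>h1, e\<rangle>, \<langle>h1, \<langle>h1, e\<rangle>\<rangle>\<rangle> = 0"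
    and f1_f2: "\<langle>\<langle>h1, f\<rangle>, \<langle>h1, \<langle>h1, f\<rangle>\<rangle>\<rangle> = 0"
begin

definition E :: "nat \<Rightarrow> 'l" where "E k = (bracket h1 ^^ k) e"
text \<open>The sign compensates [h, f] = - f, so that \<open>F k\<close> stands for f t^k.\<close>

definition F :: "nat \<Rightarrow> 'l" where "F k = (bracket (- h1) ^^ k) f"
definition H :: "nat \<Rightarrow> 'l" where "H k = \<langle>E k, f\<rangle>"

lemma E_0 [simp]: "E 0 = e" and F_0 [simp]: "F 0 = f" and H_0 [simp]: "H 0 = h"
  by (simp_all add: E_def F_def H_def e_f)

lemma h1_E [simp]: "\<langle>h1, E k\<rangle> = E (Suc k)" and h1_F [simp]: "\<langle>h1, F k\<rangle> = - F (Suc k)"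
  by (simp_all add: E_def F_def)

lemma H_1 [simp]: "H (Suc 0) = h1"
  using h1_E[of 0] by (simp add: H_def e1_f del: h1_E flip: h1_E)

lemma double_eq_0: "x + x = 0 \<Longrightarrow> x = (0 :: 'l)"
  using scale_left_distrib[of 1 1 x] by simp

text \<open>This symmetry exchanges \<open>E\<close> with \<open>F\<close> and turns
  \<open>H\<close> into - \<open>H\<close>, so that each statement about the \<open>E k\<close>
  yields one about the \<open>F k\<close>.\<close>

lemma swap: "current_algebra scale bracket f e (- h) (- h1)"
proof -
  have "\<langle>\<langle>h1, f\<rangle>, e\<rangle> = h1"
    using jacobi_right[of h1 e f] h_h1 e1_f e_f
      bracket_anticommute[of h1 h] bracket_anticommute[of e "\<langle>h1, f\<rangle>"] by simp
  then show ?thesis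
    using h_e h_f e_f h_h1 e_e1 f_f1 e1_e2 f1_f2 bracket_anticommute[of f e]
    by unfold_locales simp_all
qed

lemma swap_E: "current_algebra.E bracket f (- h1) = F"
  and swap_F: "current_algebra.F bracket e (- h1) = E"
  using current_algebra.E_def[OF swap] current_algebra.F_def[OF swap]
  by (simp_all add: fun_eq_iff E_def F_def)

lemma h_E [simp]: "\<langle>h, E k\<rangle> = E k"
proof (induction k)
  case (Suc k)
  then show ?case using jacobi_right[of h h1 "E k"] h_h1 by simp
qed (simp add: h_e)

text \<open>Bracketing [E i, E j] = 0 in degree n - 1 with \<open>h1\<close> shows that all brackets
  of degree n agree up to sign, so a single zero among them suffices. Degrees 0 and 2 contain an
  element bracketed with itself; degrees 1 and 3 are axioms. Beyond that, \<open>z\<close>, later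
  \<open>H 2\<close>, shifts the degree by 2.\<close>

lemma E_E_step:
  assumes less: "\<And>i j. i + j < n \<Longrightarrow> \<langle>E i, E j\<rangle> = 0"
    and z: "\<And>j. 0 < j \<Longrightarrow> j + 2 < n \<Longrightarrow> \<langle>z, E j\<rangle> = E (j + 2)"
    and "i + j = n"
  shows "\<langle>E i, E j\<rangle> = 0"
proof -
  have alternate: "\<langle>E (Suc i), E j\<rangle> = - \<langle>E i, E (Suc j)\<rangle>" if "Suc (i + j) = n" for i j
    using jacobi_right[of h1 "E i" "E j"] less[of i j] that by (simp add: eq_neg_iff_add_eq_0)
  have iff: "\<langle>E i, E (n - i)\<rangle> = 0 \<longleftrightarrow> \<langle>E 0, E n\<rangle> = 0" if "i \<le> n" for i
    using that
  proof (induction i)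
    case (Suc i)
    define j where "j = n - Suc i"
    have j: "Suc (i + j) = n" "n - Suc i = j" "n - i = Suc j" using Suc.prems by (simp_all add: j_def)
    have "\<langle>E (Suc i), E (n - Suc i)\<rangle> = - \<langle>E i, E (n - i)\<rangle>"
      unfolding j(2,3) by (rule alternate[OF j(1)])
    then show ?case using Suc.IH Suc.prems by (simp del: E_0)
  qed simp
  have "\<exists>i\<le>n. \<langle>E i, E (n - i)\<rangle> = 0"
  proof -
    consider "n = 0" | "n = 1" | "n = 2" | "n = 3" | "n \<ge> 4" by linarith
    then show ?thesis
    proof cases
      case 1
      then show ?thesis by (simp add: bracket_self)
    next
      case 2
      have "\<langle>E 0, E 1\<rangle> = 0" using e_e1 by (simp add: E_def)
      then show ?thesis using 2 by (intro exI[of _ 0]) simp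
    next
      case 3
      then show ?thesis by (intro exI[of _ 1]) (simp add: bracket_self)
    next
      case 4
      have "\<langle>E 1, E 2\<rangle> = 0" using e1_e2 by (simp add: E_def eval_nat_numeral)
      then show ?thesis using 4 by (intro exI[of _ 1]) simp
    next
      case 5
      define m where "m = n - 4"
      have n: "n = Suc (Suc (Suc (Suc m)))" using 5 by (simp add: m_def)
      \<comment> \<open>Bracketing [E 1, E (n - 3)] = 0 with \<open>z\<close> gives [E 3, E (n - 3)]
        + [E 1, E (n - 1)] = 0, whereas two sign changes make these summands equal; hence both
        vanish in characteristic 0.\<close>
      let ?x = "\<langle>E (Suc 0), E (Suc (Suc (Suc m)))\<rangle>"
      have "\<langle>E (Suc 0), E (Suc m)\<rangle> = 0" "\<langle>z, E (Suc 0)\<rangle> = E (Suc (Suc (Suc 0)))"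
          "\<langle>z, E (Suc m)\<rangle> = E (Suc (Suc (Suc m)))"
        using less[of "Suc 0" "Suc m"] z[of "Suc 0"] z[of "Suc m"] by (simp_all add: n)
      then have "\<langle>E (Suc (Suc (Suc 0))), E (Suc m)\<rangle> + ?x = 0"
        using jacobi_right[of z "E (Suc 0)" "E (Suc m)"] by (simp only: bracket_zero_right)
      moreover have "\<langle>E (Suc (Suc (Suc 0))), E (Suc m)\<rangle> = ?x"
        using alternate[of "Suc (Suc 0)" "Suc m"] alternate[of "Suc 0" "Suc (Suc m)"]
        by (simp only: n add_Suc add_0 minus_minus)
      ultimately have "?x + ?x = 0" by (simp only:)
      then have "?x = 0" by (rule double_eq_0)
      then show ?thesis by (intro exI[of _ "Suc 0"]) (simp only: n diff_Suc_Suc diff_zero, simp)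
    qed
  qed
  then have "\<langle>E 0, E n\<rangle> = 0" using iff by blast
  moreover have "i \<le> n" "n - i = j" using \<open>i + j = n\<close> by auto
  ultimately show ?thesis using iff[of i] by simp
qed

lemma F_F_step:
  assumes "\<And>i j. i + j < n \<Longrightarrow> \<langle>F i, F j\<rangle> = 0"
    and "\<And>j. 0 < j \<Longrightarrow> j + 2 < n \<Longrightarrow> \<langle>z, F j\<rangle> = F (j + 2)"
    and "i + j = n"
  shows "\<langle>F i, F j\<rangle> = 0"
  using current_algebra.E_E_step[OF swap, unfolded swap_E, of n z i j] assms by blast

text \<open>The six families are collected by total degree because the induction on the degree needs
  them jointly.\<close>

definition relations :: "nat \<Rightarrow> bool" where
  "relations n \<longleftrightarrow> (\<forall>i j. i + j = n \<longrightarrow>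
     \<langle>E i, E j\<rangle> = 0 \<and> \<langle>F i, F j\<rangle> = 0 \<and> \<langle>E i, F j\<rangle> = H n \<and>
     \<langle>H i, E j\<rangle> = E n \<and> \<langle>H i, F j\<rangle> = - F n \<and> \<langle>H i, H j\<rangle> = 0)"

lemma relationsD:
  assumes "relations n" "i + j = n"
  shows "\<langle>E i, E j\<rangle> = 0" "\<langle>F i, F j\<rangle> = 0" "\<langle>E i, F j\<rangle> = H n"
    "\<langle>H i, E j\<rangle> = E n" "\<langle>H i, F j\<rangle> = - F n" "\<langle>H i, H j\<rangle> = 0"
  using assms unfolding relations_def by blast+

text \<open>Bracketing [E i, F j] = H (n - 1) with \<open>h1\<close> shows that moving one degree
  from \<open>F\<close> to \<open>E\<close> adds [h1, H (n - 1)]. So for positive n everything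
  depends on the vanishing of this element, which comes from the antisymmetry of brackets between
  the \<open>H k\<close>.\<close>

lemma E_F_step:
  assumes less: "\<And>m. m < n \<Longrightarrow> relations m" and EE: "\<And>i j. i + j = n \<Longrightarrow> \<langle>E i, E j\<rangle> = 0"
    and "i + j = n"
  shows "\<langle>E i, F j\<rangle> = H n"
proof -
  have h1_H: "\<langle>E (Suc i), F j\<rangle> = \<langle>E i, F (Suc j)\<rangle> + \<langle>h1, H m\<rangle>"
    if "i + j = m" "n = Suc m" for i j m
    using jacobi_right[of h1 "E i" "F j"] relationsD(3)[OF less, of m i j] that by simp
  have h1_H_0: "\<langle>h1, H m\<rangle> = 0" if n: "n = Suc m" for m
  proof -
    have y: "\<langle>E (i + k), F j\<rangle> = \<langle>E i, F (j + k)\<rangle> + scale (of_nat k) \<langle>h1, H m\<rangle>"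
      if "i + j + k = n" for i j k
      using that
    proof (induction k arbitrary: j)
      case (Suc k)
      then show ?case
        using h1_H[of "i + k" j m] n Suc.IH[of "Suc j"] by (simp add: algebra_simps)
    qed simp
    \<comment> \<open>Writing H (n - k) as [E 1, F l] with l > 0 keeps the brackets of
      \<open>H k\<close> with both factors below degree n, where they are known.\<close>
    have H_H: "\<langle>H k, H (n - k)\<rangle> = scale (of_nat k) \<langle>h1, H m\<rangle>" if "Suc (Suc k) \<le> n" "0 < k" for k
    proof -
      define l where "l = n - Suc k"
      have l: "n = Suc (k + l)" "0 < l" using that by (auto simp: l_def)
      have "H (n - k) = \<langle>E 1, F l\<rangle>" using relationsD(3)[OF less, of "Suc l" 1 l] l that by simp
      moreover have "\<langle>H k, E 1\<rangle> = E (Suc k)" using relationsD(4)[OF less, of "Suc k" k 1] l by simp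
      moreover have "\<langle>H k, F l\<rangle> = - F (l + k)" using relationsD(5)[OF less, of "l + k" k l] l by simp
      ultimately show ?thesis using jacobi_right[of "H k" "E 1" "F l"] y[of 1 l k] l by simp
    qed
    consider "m = 0" | "m = 1" | "m = 2" | "m \<ge> 3" by linarith
    then show ?thesis
    proof cases
      case 1
      then show ?thesis using h_h1 bracket_anticommute[of h1 h] by simp
    next
      case 2
      then show ?thesis by (simp add: bracket_self)
    next
      \<comment> \<open>Here [H 2, E 1] already has degree n, so it is computed from [E 2, E 1] = 0.
        Then [H 2, h1] = 2 [h1, H 2], and antisymmetry gives 3 [h1, H 2] = 0.\<close>
      case 3
      have "\<langle>E 1, f\<rangle> = h1" "\<langle>f, E 1\<rangle> = - h1"
        using H_1 H_def bracket_anticommute[of f "E 1"] by simp_all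
      moreover have "\<langle>E 2, E 1\<rangle> = 0" using EE[of 2 1] n 3 by simp
      ultimately have "\<langle>H 2, E 1\<rangle> = E 3"
        using jacobi_left[of "E 2" f "E 1"] bracket_anticommute[of "E 2" h1]
        by (simp add: H_def eval_nat_numeral)
      moreover have "\<langle>H 2, f\<rangle> = - F 2" using relationsD(5)[OF less, of 2 2 0] n 3 by simp
      ultimately have "\<langle>H 2, h1\<rangle> = \<langle>E 3, F 0\<rangle> - \<langle>E 1, F 2\<rangle>"
        using jacobi_right[of "H 2" "E 1" f] \<open>\<langle>E 1, f\<rangle> = h1\<close> by simp
      also have "\<dots> = scale 2 \<langle>h1, H 2\<rangle>" using y[of 1 0 2] n 3 by (simp add: eval_nat_numeral)
      finally have "scale (of_nat 3) \<langle>h1, H 2\<rangle> = 0"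
        using bracket_anticommute[of "H 2" h1] scale_left_distrib[of 2 1 "\<langle>h1, H 2\<rangle>"]
        by (simp add: eq_neg_iff_add_eq_0[symmetric])
      then show ?thesis using 3 by simp
    next
      \<comment> \<open>Antisymmetry makes the multiples n - 2 and 2 of [h1, H m] cancel, so n
        [h1, H m] = 0.\<close>
      case 4
      have "\<langle>H (n - 2), H 2\<rangle> + \<langle>H 2, H (n - 2)\<rangle> = 0"
        by (simp only: bracket_anticommute[of "H (n - 2)" "H 2"] left_minus)
      moreover have "\<langle>H (n - 2), H 2\<rangle> = scale (of_nat (n - 2)) \<langle>h1, H m\<rangle>" "\<langle>H 2, H (n - 2)\<rangle> = scale (of_nat 2) \<langle>h1, H m\<rangle>"
        using H_H[of "n - 2"] H_H[of 2] n 4 by simp_all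
      ultimately have "scale (of_nat (n - 2)) \<langle>h1, H m\<rangle> + scale (of_nat 2) \<langle>h1, H m\<rangle> = 0"
        by (simp only:)
      then have "scale (of_nat (n - 2 + 2)) \<langle>h1, H m\<rangle> = 0"
        unfolding of_nat_add scale_left_distrib .
      then show ?thesis using n 4 by (simp only: scale_eq_0_iff of_nat_eq_0_iff) simp
    qed
  qed
  show ?thesis
  proof (cases n)
    case (Suc m)
    have "\<langle>E (i + k), F j\<rangle> = \<langle>E i, F (j + k)\<rangle>" if "i + j + k = n" for i j k
      using that
    proof (induction k arbitrary: j)
      case (Suc k)
      then show ?case
        using h1_H[of "i + k" j m] \<open>n = Suc m\<close> h1_H_0 Suc.IH[of "Suc j"] by simp
    qed simp
    from this[of i 0 j] show ?thesis using \<open>i + j = n\<close> by (simp add: H_def)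
  qed (use \<open>i + j = n\<close> in \<open>simp add: e_f\<close>)
qed

text \<open>By the Jacobi identity for E d, F c, E b and [E d, E b] = 0, the two \<open>E\<close>
  can trade places (\<open>flip\<close>). Two such exchanges move one degree from \<open>G\<close>
  to \<open>E\<close>, down to i = 0. The sequence \<open>G\<close> is arbitrary so that -
  \<open>H\<close> can take its place after the exchange of \<open>e\<close> and
  \<open>f\<close>.\<close>

lemma H_E_step:
  assumes EE: "\<And>i j. i + j \<le> n \<Longrightarrow> \<langle>E i, E j\<rangle> = 0"
    and EF: "\<And>i j. i + j \<le> n \<Longrightarrow> \<langle>E i, F j\<rangle> = G (i + j)"
    and "i + j = n"
  shows "\<langle>G i, E j\<rangle> = E n"
  using \<open>i + j = n\<close>
proof (induction i arbitrary: j)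
  case 0
  then show ?case using EF[of 0 0] h_E by (simp add: e_f)
next
  case (Suc i)
  have flip: "\<langle>G a, E b\<rangle> = \<langle>G (b + c), E d\<rangle>" if "c + d = a" "a + b = n" for a b c d
    using jacobi_left[of "E d" "F c" "E b"] EE[of d b] EF[of d c] EF[of b c] that
      bracket_anticommute[of "F c" "E b"] bracket_anticommute[of "E d" "G (b + c)"]
    by (simp add: add.commute)
  have "\<langle>G (Suc i), E j\<rangle> = \<langle>G (Suc j), E i\<rangle>" using flip[of 1 i "Suc i" j] Suc.prems by simp
  also have "\<dots> = \<langle>G i, E (Suc j)\<rangle>" using flip[of 0 "Suc j" "Suc j" i] Suc.prems by simp
  finally show ?case using Suc by simp
qed

lemma all_relations: "relations n"
proof (induction n rule: less_induct)
  case (less n)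
  have EE: "\<langle>E i, E j\<rangle> = 0" if "i + j \<le> n" for i j
  proof (cases "i + j = n")
    case True
    show ?thesis
      by (rule E_E_step[of n "H 2"]) (use relationsD[OF less] True in auto)
  qed (use relationsD[OF less, of "i + j" i j] that in simp)
  have FF: "\<langle>F i, F j\<rangle> = 0" if "i + j \<le> n" for i j
  proof (cases "i + j = n")
    case True
    show ?thesis
      by (rule F_F_step[of n "- H 2"]) (use relationsD[OF less] True in auto)
  qed (use relationsD[OF less, of "i + j" i j] that in simp)
  have EF: "\<langle>E i, F j\<rangle> = H (i + j)" if "i + j \<le> n" for i j
  proof (cases "i + j = n")
    case True
    then show ?thesis using E_F_step[of n i j] less EE by simp
  qed (use relationsD[OF less, of "i + j" i j] that in simp)
  then have FE: "\<langle>F i, E j\<rangle> = - H (i + j)" if "i + j \<le> n" for i j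
    using that bracket_anticommute[of "F i" "E j"] by (simp add: add.commute)
  have HE: "\<langle>H i, E j\<rangle> = E n" if "i + j = n" for i j
    by (rule H_E_step[of n H]) (use EE EF that in auto)
  have HF: "\<langle>H i, F j\<rangle> = - F n" if "i + j = n" for i j
    using current_algebra.H_E_step[OF swap, unfolded swap_E swap_F, of n "\<lambda>k. - H k" i j] FF FE that
    by (simp add: minus_equation_iff[of _ "F n"])
  \<comment> \<open>Expanding H j as [E j, F 0] leaves [E n, F 0] - [E j, F i], and both brackets
    are H n.\<close>
  have "\<langle>H i, H j\<rangle> = 0" if "i + j = n" for i j
  proof -
    have "\<langle>H i, F 0\<rangle> = - F i"
      using relationsD(5)[OF less, of i i 0] HF[of i 0] that by (cases "i = n") auto
    then show ?thesis
      using jacobi_right[of "H i" "E j" "F 0"] HE[OF that] EF[of j i] EF[of n 0] EF[of j 0] that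
      by (simp add: add.commute)
  qed
  then show ?case using EE FF EF HE HF by (simp add: relations_def)
qed

end

context lie_algebra
begin

lemma bracket_sum_left: "\<langle>sum g A, x\<rangle> = (\<Sum>a\<in>A. \<langle>g a, x\<rangle>)"
  by (induction A rule: infinite_finite_induct) (simp_all add: bracket_add_left)

end

context current_algebra
begin

lemma E_E: "\<langle>E i, E j\<rangle> = 0" and F_F: "\<langle>F i, F j\<rangle> = 0"
  and E_F: "\<langle>E i, F j\<rangle> = H (i + j)"
  and H_E: "\<langle>H i, E j\<rangle> = E (i + j)" and H_F: "\<langle>H i, F j\<rangle> = - F (i + j)"
  and H_H: "\<langle>H i, H j\<rangle> = 0"
  using relationsD[OF all_relations HOL.refl] by blast+

text \<open>The assumptions express g = a e / (t - c) without division: t g = c g + a e, seen once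
  under the bracket with \<open>h1\<close> and once under the bracket with \<open>f\<close>.\<close>

context
  fixes g c a
  assumes e_g: "\<langle>e, g\<rangle> = 0"
    and h1_g: "\<langle>h1, g\<rangle> = scale c g + scale a e"
    and g_f1: "\<langle>g, F 1\<rangle> = scale c \<langle>g, f\<rangle> + scale a h"
begin

lemma E_g: "\<langle>E k, g\<rangle> = 0"
proof (induction k)
  case (Suc k)
  have "\<langle>E k, \<langle>h1, g\<rangle>\<rangle> = 0"
    using Suc E_E[of k 0] by (simp add: h1_g bracket_add_right bracket_scale_right)
  then show ?case using jacobi_right[of h1 "E k" g] Suc by simp
qed (simp add: e_g)

text \<open>The claim is equivalent to [h1, [g, F k]] = 0, and this passes from k to k + 1 because
  \<open>h1\<close> commutes with \<open>H k\<close>.\<close>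

lemma g_F_Suc: "\<langle>g, F (Suc k)\<rangle> = scale c \<langle>g, F k\<rangle> + scale a (H k)"
proof -
  have step: "\<langle>h1, \<langle>g, F k\<rangle>\<rangle> = scale c \<langle>g, F k\<rangle> + scale a (H k) - \<langle>g, F (Suc k)\<rangle>" for k
    using jacobi_right[of h1 g "F k"] E_F[of 0 k]
    by (simp add: h1_g bracket_add_left bracket_scale_left)
  have "\<langle>h1, \<langle>g, F k\<rangle>\<rangle> = 0"
  proof (induction k)
    case 0
    then show ?case using step[of 0] g_f1 by simp
  next
    case (Suc k)
    have "\<langle>g, F (Suc k)\<rangle> = scale c \<langle>g, F k\<rangle> + scale a (H k)"
      using step[of k] unfolding Suc by (metis eq_iff_diff_eq_0)
    then show ?case using Suc H_H[of 1 k]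
      by (simp add: bracket_add_right bracket_scale_right)
  qed
  then show ?thesis using step[of k] by simp
qed

lemma h1_power_g_Suc: "(bracket h1 ^^ Suc k) g = scale c ((bracket h1 ^^ k) g) + scale a (E k)"
  by (induction k) (simp_all add: h1_g bracket_add_right bracket_scale_right)

text \<open>Splitting H (k + 1) as [E k, F 1] puts the additional factor t next to \<open>g\<close>,
  where \<open>g_f1\<close> replaces it by c and a multiple of \<open>h\<close>.\<close>

lemma H_g:
  assumes "\<langle>h, g\<rangle> = g"
  shows "\<langle>H k, g\<rangle> = (bracket h1 ^^ k) g"
proof (induction k)
  case (Suc k)
  have "\<langle>H (Suc k), g\<rangle> = \<langle>\<langle>E k, F 1\<rangle>, g\<rangle>" by (simp add: E_F)
  also have "\<dots> = \<langle>E k, \<langle>F 1, g\<rangle>\<rangle>" using E_g by (simp add: jacobi_left)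
  also have "\<dots> = - \<langle>E k, scale c \<langle>g, f\<rangle> + scale a h\<rangle>"
    by (simp only: bracket_anticommute[of "F 1" g] g_f1 bracket_minus_right)
  also have "\<dots> = - scale c \<langle>E k, \<langle>g, f\<rangle>\<rangle> + scale a (E k)"
    using H_E[of 0 k] bracket_anticommute[of "E k" h]
    by (simp add: bracket_add_right bracket_scale_right)
  also have "\<langle>E k, \<langle>g, f\<rangle>\<rangle> = - \<langle>H k, g\<rangle>"
    using jacobi_right[of "E k" g f] E_g[of k] bracket_anticommute[of g "H k"] by (simp add: H_def)
  finally show ?case using h1_power_g_Suc[of k] Suc by simp
qed (simp add: assms)

text \<open>Modulo an ideal of finite codimension, \<open>g\<close> is \<open>a e / (t - c)\<close>. A minimal relation \<open>q(t) e = 0\<close>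
  gives \<open>q(t) g = 0\<close> by bracketing with \<open>q(t) h = 0\<close>; then \<open>q(c) \<noteq> 0\<close>, since otherwise \<open>q\<close> could be
  divided by \<open>t - c\<close>, and so \<open>t - c\<close> can be inverted modulo \<open>q\<close>.\<close>

lemma g_in_span_E_mod_ideal:
  assumes h_g: "\<langle>h, g\<rangle> = g" and "a \<noteq> 0"
    and K: "subspace K" "\<And>x y. y \<in> K \<Longrightarrow> \<langle>x, y\<rangle> \<in> K"
    and q: "(\<Sum>k\<le>n. scale (q k) (E k)) \<in> K" "q n = 1"
    and indep: "\<And>d. (\<Sum>k<n. scale (d k) (E k)) \<in> K \<Longrightarrow> (\<forall>k<n. d k = 0)"
  obtains d where "g - (\<Sum>k<n. scale (d k) (E k)) \<in> K"
proof -
  have K': "\<langle>x, y\<rangle> \<in> K" if "x \<in> K" for x y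
    using K(2)[OF that, of y] subspace_neg[OF K(1)] bracket_anticommute[of x y] by metis
  define x where "x k = (bracket h1 ^^ k) g" for k
  have x_Suc: "x (Suc j) - scale c (x j) = scale a (E j)" for j
    using h1_power_g_Suc[of j] by (simp add: x_def)
  have "\<langle>\<langle>\<Sum>k\<le>n. scale (q k) (E k), f\<rangle>, g\<rangle> \<in> K" using q by (intro K')
  also have "\<langle>\<langle>\<Sum>k\<le>n. scale (q k) (E k), f\<rangle>, g\<rangle> = (\<Sum>k\<le>n. scale (q k) (x k))"
    by (simp add: bracket_sum_left bracket_scale_left x_def H_g[OF h_g] flip: H_def)
  finally have x: "(\<Sum>k\<le>n. scale (q k) (x k)) \<in> K" .
  define b where "b = (\<Sum>k\<le>n. q k * c ^ k)"
  obtain r where r: "0 < n \<Longrightarrow> r (n - 1) = q n"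
    and div: "\<And>x. (\<Sum>j<n. scale (r j) (x (Suc j) - scale c (x j))) =
       (\<Sum>k\<le>n. scale (q k) (x k)) - scale b (x 0)"
    using synthetic_division[of n q c] unfolding b_def by metis
  have "(\<Sum>k\<le>n. scale (q k) (x k)) = scale b g + (\<Sum>j<n. scale (r j * a) (E j))"
    using div[of x] unfolding x_Suc by (simp add: x_def algebra_simps)
  with x have in_K: "scale b g + (\<Sum>j<n. scale (r j * a) (E j)) \<in> K" by simp
  have "b \<noteq> 0"
  proof
    assume "b = 0"
    then have "(\<Sum>j<n. scale (r j * a) (E j)) \<in> K" using in_K by simp
    then have "\<forall>j<n. r j * a = 0" by (rule indep)
    then have "n = 0" using r q(2) \<open>a \<noteq> 0\<close> by (cases n) auto
    then show False using \<open>b = 0\<close> q(2) by (simp add: b_def)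
  qed
  have "scale (1 / b) (scale b g + (\<Sum>j<n. scale (r j * a) (E j))) \<in> K"
    using K(1) in_K by (rule subspace_scale)
  then have "g - (\<Sum>k<n. scale (- (r k * a / b)) (E k)) \<in> K"
    using \<open>b \<noteq> 0\<close> by (simp add: scale_right_distrib scale_sum_right sum_negf)
  then show thesis by (rule that)
qed

end

end

section \<open>The current algebra inside the tetrahedron algebra\<close>

lemma (in vector_space) scale_2: "scale 2 x = x + x"
  using scale_left_distrib[of 1 1 x] by simp

lemma (in vector_space) scale_4: "scale 4 x = x + x + x + x"
  using scale_left_distrib[of 2 2 x] by (simp add: scale_2 add.assoc)

text \<open>The variables stand for \<open>x = x\<^sub>1\<^sub>2\<close>, \<open>y = x\<^sub>2\<^sub>3\<close>, \<open>z = x\<^sub>3\<^sub>1\<close>, \<open>u = x\<^sub>0\<^sub>3\<close>, \<open>v = x\<^sub>0\<^sub>1\<close>, \<open>w = x\<^sub>2\<^sub>0\<close>.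
  The definitions below are read off from the realisation of \<open>\<boxtimes>\<close> as
  \<open>sl\<^sub>2 \<otimes> F[t, 1/t, 1/(1 - t)]\<close> with \<open>x = 2 h\<close>, \<open>y = e - 2 h\<close>, \<open>z = - 8 f - 2 h\<close> and
  \<open>u = t e + 8 (1 - t) f - 2 (2 t - 1) h\<close>, where \<open>h\<close> is half of the usual one: \<open>h1\<close> is \<open>t h\<close>. The double bracket
  \<open>\<langle>h, \<langle>h, u\<rangle>\<rangle>\<close> is the sum of the components of \<open>u\<close> of nonzero weight.\<close>

locale tetrahedron = lie_algebra scale bracket
  for scale :: "'f::field_char_0 \<Rightarrow> 'l::ab_group_add \<Rightarrow> 'l" and bracket +
  fixes x y z u v w :: 'l
  assumes xy: "\<langle>x, y\<rangle> = scale 2 x + scale 2 y"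
    and yz: "\<langle>y, z\<rangle> = scale 2 y + scale 2 z"
    and zx: "\<langle>z, x\<rangle> = scale 2 z + scale 2 x"
    and yu: "\<langle>y, u\<rangle> = scale 2 u - scale 2 y"
    and zu: "\<langle>z, u\<rangle> = - scale 2 z - scale 2 u"
    and xw: "\<langle>x, w\<rangle> = scale 2 x + scale 2 w"
    and yw: "\<langle>y, w\<rangle> = scale 2 y - scale 2 w"
    and wu: "\<langle>w, u\<rangle> = scale 2 w + scale 2 u"
    and vx: "\<langle>v, x\<rangle> = scale 2 v + scale 2 x"
    and zv: "\<langle>z, v\<rangle> = scale 2 v - scale 2 z"
    and vu: "\<langle>v, u\<rangle> = scale 2 v - scale 2 u"
    and xxxu: "\<langle>x, \<langle>x, \<langle>x, u\<rangle>\<rangle>\<rangle> = scale 4 \<langle>x, u\<rangle>"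
    and uuux: "\<langle>u, \<langle>u, \<langle>u, x\<rangle>\<rangle>\<rangle> = scale 4 \<langle>u, x\<rangle>"
begin

definition h where "h = scale (1 / 2) x"
definition e where "e = x + y"
definition f where "f = scale (- 1 / 8) (x + z)"
definition h1 where "h1 = scale (1 / 4) (x - u + \<langle>h, \<langle>h, u\<rangle>\<rangle>)"

text \<open>In the realisation \<open>F'\<close> is - 8 f, \<open>P\<close> is t e - 8 (1 - t) f,
  \<open>Q\<close> is t e + 8 (1 - t) f and \<open>T\<close> is 4 t h. These multiples keep
  fractions out of the computations.\<close>

abbreviation "F' \<equiv> x + z"
abbreviation "P \<equiv> \<langle>h, u\<rangle>"
abbreviation "Q \<equiv> \<langle>h, \<langle>h, u\<rangle>\<rangle>"
abbreviation "T \<equiv> x - u + Q"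

lemma halve: "a + a = b + b \<Longrightarrow> a = (b :: 'l)"
  using scale_cancel_left[of 2 a b] by (simp add: scale_2)

lemma double_h: "\<langle>h, a\<rangle> + \<langle>h, a\<rangle> = \<langle>x, a\<rangle>"
  by (simp add: h_def bracket_scale_left flip: scale_left_distrib)

lemma x_bracket: "\<langle>x, a\<rangle> = scale 2 \<langle>h, a\<rangle>"
  by (simp add: scale_2 double_h)

lemma h_e: "\<langle>h, e\<rangle> = e"
  by (rule halve) (simp add: double_h e_def xy bracket_add_right bracket_self scale_2 algebra_simps)

lemma xz: "\<langle>x, z\<rangle> = - scale 2 z - scale 2 x"
  using bracket_anticommute[of x z] by (simp add: zx)

lemma yx: "\<langle>y, x\<rangle> = - scale 2 x - scale 2 y"
  using bracket_anticommute[of y x] by (simp add: xy)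

lemma h_F': "\<langle>h, F'\<rangle> = - F'"
  by (rule halve) (simp add: double_h xz bracket_add_right bracket_self scale_2 algebra_simps)

lemma h_x: "\<langle>h, x\<rangle> = 0"
  by (simp add: h_def bracket_scale_left bracket_self)

text \<open>The relation \<open>xxxu\<close> says that ad h and its cube agree on \<open>u\<close>,
  so \<open>u\<close> has only components of weight -1, 0 and 1.\<close>

lemma h_Q: "\<langle>h, Q\<rangle> = P"
proof -
  have "\<langle>h, Q\<rangle> = scale (1 / 8) \<langle>x, \<langle>x, \<langle>x, u\<rangle>\<rangle>\<rangle>"
    by (simp add: h_def bracket_scale_left bracket_scale_right)
  then show ?thesis by (simp add: xxxu h_def bracket_scale_left)
qed

lemma e_F': "\<langle>e, F'\<rangle> = - scale 4 x"
  by (simp add: e_def bracket_add_left bracket_add_right bracket_self yz xz yx)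
    (simp add: scale_2 scale_4 algebra_simps)

lemma e_u: "\<langle>e, u\<rangle> = scale 2 u - scale 2 e + scale 2 x + scale 2 P"
  by (simp add: yu x_bracket e_def bracket_add_left algebra_simps)

lemma bracket_h_right: "\<langle>h, a\<rangle> = b \<Longrightarrow> \<langle>a, h\<rangle> = - b"
  using bracket_anticommute by blast

lemma e_P: "\<langle>e, P\<rangle> = scale 2 Q - scale 2 u - scale 2 x"
  by (simp add: jacobi_right[of e h u] bracket_h_right[OF h_e] e_u h_e h_x
      bracket_add_right bracket_diff_right bracket_scale_right)

lemma e_Q: "\<langle>e, Q\<rangle> = scale 2 u + scale 2 x - scale 2 Q"
  by (simp add: jacobi_right[of e h P] bracket_h_right[OF h_e] e_P h_Q h_x
      bracket_add_right bracket_diff_right bracket_scale_right)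

lemma F'_u: "\<langle>F', u\<rangle> = scale 2 x - scale 2 F' - scale 2 u + scale 2 P"
  by (simp add: zu x_bracket bracket_add_left) (simp add: algebra_simps)

lemma F'_P: "\<langle>F', P\<rangle> = scale 2 x - scale 2 u + scale 2 Q"
proof -
  have "\<langle>F', P\<rangle> = \<langle>F', u\<rangle> + \<langle>h, \<langle>F', u\<rangle>\<rangle>"
    unfolding jacobi_right[of F' h u] bracket_h_right[OF h_F'] minus_minus ..
  also have "\<langle>h, \<langle>F', u\<rangle>\<rangle> = scale 2 F' - scale 2 P + scale 2 Q"
    unfolding F'_u bracket_add_right[of h _ "scale 2 P"] bracket_diff_right bracket_scale_right h_x h_F'
      scale_minus_right
    by simp
  finally show ?thesis unfolding F'_u by (simp add: scale_2 algebra_simps)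
qed

lemma F'_Q: "\<langle>F', Q\<rangle> = scale 2 x - scale 2 u + scale 2 Q"
proof -
  have "\<langle>F', Q\<rangle> = \<langle>F', P\<rangle> + \<langle>h, \<langle>F', P\<rangle>\<rangle>"
    unfolding jacobi_right[of F' h P] bracket_h_right[OF h_F'] minus_minus ..
  also have "\<langle>h, \<langle>F', P\<rangle>\<rangle> = 0"
    unfolding F'_P bracket_add_right[of h] bracket_diff_right bracket_scale_right h_x h_Q by simp
  finally show ?thesis unfolding F'_P by simp
qed

text \<open>The components of 2 u of weight 1 and -1, which are 2 t e and 16 (1 - t) f in the
  realisation.\<close>

abbreviation "p \<equiv> Q + P"
abbreviation "m \<equiv> Q - P"

lemma h_p: "\<langle>h, p\<rangle> = p" and h_m: "\<langle>h, m\<rangle> = - m" and h_u_Q: "\<langle>h, u - Q\<rangle> = 0"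
  by (simp_all add: bracket_add_right bracket_diff_right h_Q)

lemma e_p: "\<langle>e, p\<rangle> = 0" and F'_m: "\<langle>F', m\<rangle> = 0"
  by (simp_all only: bracket_add_right[of e] bracket_diff_right e_P e_Q F'_P F'_Q) simp_all

lemma p_F': "\<langle>p, F'\<rangle> = - scale 4 T"
proof -
  have "\<langle>F', p\<rangle> = scale 4 T"
    unfolding bracket_add_right[of F'] F'_P F'_Q by (simp add: scale_2 scale_4 algebra_simps)
  then show ?thesis using bracket_anticommute[of p F'] by simp
qed

lemma T_left: "\<langle>T, a\<rangle> = scale 2 \<langle>h, a\<rangle> + \<langle>a, u\<rangle> - \<langle>a, Q\<rangle>"
  unfolding bracket_add_left bracket_diff_left bracket_anticommute[of u a] bracket_anticommute[of Q a]
  by (simp add: x_bracket)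

lemma T_e: "\<langle>T, e\<rangle> = scale 2 p"
  unfolding T_left h_e e_u e_Q by (simp add: algebra_simps)

lemma T_F': "\<langle>T, F'\<rangle> = - scale 4 F' - scale 2 m"
  unfolding T_left h_F' F'_u F'_Q by (simp add: scale_2 scale_4 algebra_simps)

lemma bracket_weight:
  assumes "\<langle>h, a\<rangle> = scale i a" "\<langle>h, b\<rangle> = scale j b"
  shows "\<langle>h, \<langle>a, b\<rangle>\<rangle> = scale (i + j) \<langle>a, b\<rangle>"
  using assms by (simp add: jacobi_right bracket_scale_left bracket_scale_right scale_left_distrib)

text \<open>These are the components of weight 2 and -2 of the relation \<open>uuux\<close>, where
  \<open>u\<close> is half of p + m plus the part u - Q of weight 0. Sums are doubled to avoid
  fractions. The result supplies the relations of degree 3 in the current algebra.\<close>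

lemma cubic: "\<langle>p, \<langle>u - Q, p\<rangle>\<rangle> = 0" "\<langle>m, \<langle>u - Q, m\<rangle>\<rangle> = 0"
proof -
  define n where "n = u - Q"
  define a where "a = Q + P"
  define b where "b = Q - P"
  have u: "u + u = a + b + n + n" by (simp add: a_def b_def n_def)
  have wt: "\<langle>h, a\<rangle> = scale 1 a" "\<langle>h, b\<rangle> = scale (- 1) b" "\<langle>h, n\<rangle> = scale 0 n"
    using h_p h_m h_u_Q by (simp_all add: a_def b_def n_def)
  have uu: "\<langle>u, c\<rangle> + \<langle>u, c\<rangle> = \<langle>a, c\<rangle> + \<langle>b, c\<rangle> + \<langle>n, c\<rangle> + \<langle>n, c\<rangle>" for c
    unfolding bracket_add_left[symmetric] u ..
  have ux: "\<langle>u, x\<rangle> = b - a"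
    using bracket_anticommute[of u x] by (simp add: x_bracket scale_2 a_def b_def)
  define c where "c = \<langle>a, b\<rangle> + \<langle>n, b\<rangle> - \<langle>n, a\<rangle>"
  have uux: "\<langle>u, \<langle>u, x\<rangle>\<rangle> = c"
    by (rule halve, unfold ux, unfold uu, unfold c_def bracket_diff_right bracket_self bracket_anticommute[of b a]) simp
  have "\<langle>a, c\<rangle> + \<langle>b, c\<rangle> + \<langle>n, c\<rangle> + \<langle>n, c\<rangle> = scale 4 (b - a) + scale 4 (b - a)"
    using uuux unfolding uux unfolding ux by (simp flip: uu)
  then have sum0: "- \<langle>a, \<langle>n, a\<rangle>\<rangle>
      + (\<langle>a, \<langle>a, b\<rangle>\<rangle> - \<langle>n, \<langle>n, a\<rangle>\<rangle> - \<langle>n, \<langle>n, a\<rangle>\<rangle> + scale 4 a + scale 4 a)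
      + (\<langle>a, \<langle>n, b\<rangle>\<rangle> - \<langle>b, \<langle>n, a\<rangle>\<rangle> + \<langle>n, \<langle>a, b\<rangle>\<rangle> + \<langle>n, \<langle>a, b\<rangle>\<rangle>)
      + (\<langle>b, \<langle>a, b\<rangle>\<rangle> + \<langle>n, \<langle>n, b\<rangle>\<rangle> + \<langle>n, \<langle>n, b\<rangle>\<rangle> - scale 4 b - scale 4 b)
      + \<langle>b, \<langle>n, b\<rangle>\<rangle> = 0" (is "?s2 + ?s1 + ?s0 + ?t1 + ?t2 = 0")
    by (simp add: c_def bracket_add_right bracket_diff_right algebra_simps)
  have brackets: "\<langle>h, \<langle>a, b\<rangle>\<rangle> = scale 0 \<langle>a, b\<rangle>" "\<langle>h, \<langle>n, a\<rangle>\<rangle> = scale 1 \<langle>n, a\<rangle>"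
      "\<langle>h, \<langle>n, b\<rangle>\<rangle> = scale (- 1) \<langle>n, b\<rangle>"
    using bracket_weight[OF wt(1,2)] bracket_weight[OF wt(3,1)] bracket_weight[OF wt(3,2)] by simp_all
  have wts: "\<langle>h, ?s2\<rangle> = scale 2 ?s2" "\<langle>h, ?s1\<rangle> = scale 1 ?s1" "\<langle>h, ?s0\<rangle> = scale 0 ?s0"
    "\<langle>h, ?t1\<rangle> = scale (- 1) ?t1" "\<langle>h, ?t2\<rangle> = scale (- 2) ?t2"
    using bracket_weight[OF wt(1) brackets(1)] bracket_weight[OF wt(1) brackets(2)]
      bracket_weight[OF wt(1) brackets(3)] bracket_weight[OF wt(2) brackets(1)]
      bracket_weight[OF wt(2) brackets(2)] bracket_weight[OF wt(2) brackets(3)]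
      bracket_weight[OF wt(3) brackets(1)] bracket_weight[OF wt(3) brackets(2)]
      bracket_weight[OF wt(3) brackets(3)] wt
    by (simp_all add: bracket_add_right bracket_diff_right bracket_scale_right)
  define s where "s i = [?t2, ?t1, ?s0, ?s1, ?s2] ! i" for i
  have "(\<Sum>i<5. s i) = 0" using sum0 by (simp add: s_def eval_nat_numeral algebra_simps)
  moreover have "\<langle>h, s i\<rangle> = scale (of_nat i - 2) (s i)" if "i \<in> {..<5}" for i
  proof -
    from that have "i \<in> {0, 1, 2, 3, 4}" by auto
    then show ?thesis using wts by (auto simp: s_def numeral_eq_Suc)
  qed
  ultimately have s: "s i = 0" if "i < 5" for i
    using eigenvectors_sum_zero[OF linear_bracket, of "{..<5}" "\<lambda>i. of_nat i - 2" h s i] that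
    by (simp add: inj_on_def)
  show "\<langle>p, \<langle>u - Q, p\<rangle>\<rangle> = 0" "\<langle>m, \<langle>u - Q, m\<rangle>\<rangle> = 0"
    using s[of 4] s[of 0] by (simp_all add: s_def a_def b_def n_def)
qed

text \<open>\<open>T\<close> is x - (u - Q), and \<open>x\<close> multiplies \<open>p\<close> and
  \<open>m\<close> by scalars, so only the part treated in \<open>cubic\<close> matters.\<close>

lemma p_T_p: "\<langle>p, \<langle>T, p\<rangle>\<rangle> = 0" and m_T_m: "\<langle>m, \<langle>T, m\<rangle>\<rangle> = 0"
proof -
  have T: "\<langle>T, a\<rangle> = scale 2 \<langle>h, a\<rangle> - \<langle>u - Q, a\<rangle>" for a
    by (simp add: bracket_add_left bracket_diff_left x_bracket)
  show "\<langle>p, \<langle>T, p\<rangle>\<rangle> = 0" "\<langle>m, \<langle>T, m\<rangle>\<rangle> = 0"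
    unfolding T h_p h_m bracket_diff_right[of p] bracket_diff_right[of m "scale 2 (- m)"]
      bracket_scale_right cubic bracket_minus_right bracket_self by simp_all
qed

lemma h1_e: "\<langle>h1, e\<rangle> = scale (1 / 2) p"
  unfolding h1_def bracket_scale_left T_e by simp

lemma h1_f: "\<langle>h1, f\<rangle> = scale (1 / 16) (scale 2 F' + m)"
proof -
  have "\<langle>h1, f\<rangle> = scale (- 1 / 32) \<langle>T, F'\<rangle>"
    unfolding h1_def f_def bracket_scale_left bracket_scale_right by simp
  then show ?thesis unfolding T_F' by (simp add: scale_right_distrib scale_right_diff_distrib)
qed

lemma h_h: "h + h = x"
  by (simp add: h_def flip: scale_left_distrib)

sublocale current_algebra scale bracket e f h h1
proof
  show "\<langle>h, e\<rangle> = e" by (rule h_e)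
  show "\<langle>h, f\<rangle> = - f" unfolding f_def bracket_scale_right h_F' by (rule scale_minus_right)
  show "\<langle>e, f\<rangle> = h" unfolding f_def bracket_scale_right e_F' by (simp add: h_def)
  show "\<langle>h, h1\<rangle> = 0"
    unfolding h1_def bracket_scale_right by (simp add: bracket_add_right bracket_diff_right h_x h_Q)
  show "\<langle>\<langle>h1, e\<rangle>, f\<rangle> = h1"
    unfolding h1_e f_def bracket_scale_right bracket_scale_left p_F' by (simp add: h1_def)
  show "\<langle>e, \<langle>h1, e\<rangle>\<rangle> = 0" unfolding h1_e bracket_scale_right e_p by simp
  show "\<langle>f, \<langle>h1, f\<rangle>\<rangle> = 0"
    unfolding h1_f unfolding f_def bracket_scale_right bracket_scale_left bracket_add_right[of F' "scale 2 F'"]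
      bracket_self F'_m by simp
  show "\<langle>\<langle>h1, e\<rangle>, \<langle>h1, \<langle>h1, e\<rangle>\<rangle>\<rangle> = 0"
    unfolding h1_e unfolding h1_def bracket_scale_right bracket_scale_left p_T_p by simp
  \<comment> \<open>In the realisation \<open>n\<close> is - 16 t f, while \<open>m\<close> is 16 (1
    - t) f. The relation known for \<open>m\<close> carries over to \<open>n\<close> because F'
    commutes with \<open>m\<close> and with [T, m].\<close>
  define n where "n = scale 2 F' + m"
  have "\<langle>F', \<langle>T, m\<rangle>\<rangle> = \<langle>\<langle>F', T\<rangle>, m\<rangle>"
    unfolding jacobi_right[of F' T m] F'_m by simp
  also have "\<dots> = 0"
    unfolding bracket_anticommute[of F' T] T_F' bracket_minus_left bracket_diff_left[of _ _ m]
      bracket_scale_left F'_m bracket_self by simp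
  finally have "\<langle>n, \<langle>T, m\<rangle>\<rangle> = 0"
    unfolding n_def bracket_add_left[of _ m] bracket_scale_left m_T_m by simp
  moreover have "\<langle>T, n\<rangle> = scale (- 4) n + \<langle>T, m\<rangle>"
    unfolding n_def bracket_add_right[of T _ m] bracket_scale_right T_F'
    by (simp add: scale_right_diff_distrib scale_right_distrib)
  ultimately have "\<langle>n, \<langle>T, n\<rangle>\<rangle> = 0"
    by (simp only: bracket_add_right[of n] bracket_scale_right bracket_self) simp
  then show "\<langle>\<langle>h1, f\<rangle>, \<langle>h1, \<langle>h1, f\<rangle>\<rangle>\<rangle> = 0"
    unfolding h1_f n_def[symmetric] unfolding h1_def bracket_scale_right bracket_scale_left by simp
qed

section \<open>The elements with a pole and their brackets with the current algebra\<close>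

lemma xv: "\<langle>x, v\<rangle> = - scale 2 v - scale 2 x"
  using bracket_anticommute[of x v] by (simp add: vx)

lemma h_y: "\<langle>h, y\<rangle> = x + y" and h_w: "\<langle>h, w\<rangle> = x + w"
  and h_z: "\<langle>h, z\<rangle> = - x - z" and h_v: "\<langle>h, v\<rangle> = - x - v"
  by (rule halve, simp add: double_h xy xz xw xv scale_2 algebra_simps)+

text \<open>In that realisation \<open>g = e / (1 - t)\<close> and \<open>k = - 8 f / t\<close>.\<close>

definition g where "g = y - w"
definition k where "k = z - v"

lemma h_g: "\<langle>h, g\<rangle> = g" and h_k: "\<langle>h, k\<rangle> = - k"
  by (simp_all add: g_def k_def bracket_diff_right h_y h_w h_z h_v)

lemma e_g: "\<langle>e, g\<rangle> = 0" and F'_k: "\<langle>F', k\<rangle> = 0"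
  by (simp_all add: e_def g_def k_def bracket_add_left bracket_diff_right bracket_self xy xw yw xz xv zv)

lemma g_u: "\<langle>g, u\<rangle> = - scale 2 y - scale 2 w" and k_u: "\<langle>k, u\<rangle> = - scale 2 z - scale 2 v"
  by (simp_all add: g_def k_def bracket_diff_left yu wu zu vu)

lemma g_P: "\<langle>g, P\<rangle> = - scale 4 x"
  unfolding jacobi_right[of g h u] bracket_h_right[OF h_g] bracket_minus_left g_u
    bracket_diff_right bracket_minus_right bracket_scale_right h_y h_w
  by (simp add: scale_2 scale_4 algebra_simps)

lemma g_Q: "\<langle>g, Q\<rangle> = scale 4 x"
  unfolding jacobi_right[of g h P] bracket_h_right[OF h_g] bracket_minus_left g_P
    bracket_minus_right bracket_scale_right h_x by simp

lemma k_P: "\<langle>k, P\<rangle> = scale 4 x"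
  unfolding jacobi_right[of k h u] bracket_h_right[OF h_k] minus_minus k_u
    bracket_diff_right bracket_minus_right bracket_scale_right h_z h_v
  by (simp add: scale_2 scale_4 algebra_simps)

lemma k_Q: "\<langle>k, Q\<rangle> = scale 4 x"
  unfolding jacobi_right[of k h P] bracket_h_right[OF h_k] minus_minus k_P
    bracket_scale_right h_x by simp

lemma T_g: "\<langle>T, g\<rangle> = - scale 4 x - scale 4 w"
  unfolding T_left h_g g_u g_Q by (simp add: g_def scale_2 scale_4 algebra_simps)

lemma T_k: "\<langle>T, k\<rangle> = - scale 4 F'"
  unfolding T_left h_k k_u k_Q by (simp add: k_def scale_2 scale_4 algebra_simps)

lemma h1_g: "\<langle>h1, g\<rangle> = g - e"
  unfolding h1_def bracket_scale_left T_g by (simp add: g_def e_def scale_right_diff_distrib)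

lemma h1_k: "\<langle>h1, k\<rangle> = - F'"
  unfolding h1_def bracket_scale_left T_k by (simp add: scale_right_diff_distrib scale_right_distrib)

lemma F_1: "F (Suc 0) = f - scale (1 / 16) m"
proof -
  have "\<langle>h1, f\<rangle> = - f + scale (1 / 16) m"
    unfolding h1_f by (simp add: f_def scale_right_distrib)
  then show ?thesis by (simp add: F_def)
qed

lemma E_1: "E (Suc 0) = scale (1 / 2) p"
  by (simp add: E_def h1_e)

lemma g_F_1: "\<langle>g, F (Suc 0)\<rangle> = \<langle>g, f\<rangle> - h"
  unfolding F_1 bracket_diff_right bracket_scale_right g_P g_Q
  by (simp add: h_def flip: scale_left_distrib)

lemma k_E_1: "\<langle>k, E (Suc 0)\<rangle> = scale 8 h"
  unfolding E_1 bracket_scale_right bracket_add_right g_P k_P k_Q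
  by (simp add: h_def flip: scale_left_distrib)

end

section \<open>Highest and lowest weight vectors\<close>

context lie_module
begin

lemma linear_act: "Vector_Spaces.linear vscale vscale (act a)"
  by (simp add: Vector_Spaces.linear_iff V.vector_space_axioms act_add_right act_scale_right)

lemma act_0_right [simp]: "act a 0 = 0"
  using act_scale_right[of a 0 0] by simp

lemma act_minus_right [simp]: "act a (- v) = - act a v"
  using act_scale_right[of a "- 1" v] by simp

lemma act_diff_right: "act a (v - w) = act a v - act a w"
  using act_add_right[of a v "- w"] by simp

lemma act_0_left [simp]: "act 0 v = 0"
  using act_scale_left[of 0 0 v] by simp

lemma act_minus_left [simp]: "act (- a) v = - act a v"
  using act_scale_left[of "- 1" a v] by simp

lemma act_diff_left: "act (a - b) v = act a v - act b v"
  using act_add_left[of a "- b" v] by simp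

lemma act_sum_left: "act (sum s A) v = (\<Sum>a\<in>A. act (s a) v)"
  by (induction A rule: infinite_finite_induct) (simp_all add: act_add_left)

lemma act_commute: "act a (act b v) = act b (act a v) + act (bracket a b) v"
  by (simp add: act_bracket)

definition annihilator where "annihilator = {a. \<forall>v. act a v = 0}"

lemma subspace_annihilator: "L.subspace annihilator"
  by (rule L.subspaceI) (auto simp: annihilator_def act_add_left act_scale_left)

lemma bracket_annihilator: "b \<in> annihilator \<Longrightarrow> bracket a b \<in> annihilator"
  by (simp add: annihilator_def act_bracket)

text \<open>Modulo the kernel of the action the Lie algebra embeds into the linear maps of a
  finite-dimensional space, so every sequence in it satisfies a minimal relation there.\<close>

lemma first_dependent_mod_annihilator:
  fixes s :: "nat \<Rightarrow> 'l"
  assumes "finite_dimensional vscale"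
  obtains n q where "(\<Sum>k\<le>n. scale (q k) (s k)) \<in> annihilator" "q n = 1"
    "\<And>d. (\<Sum>k<n. scale (d k) (s k)) \<in> annihilator \<Longrightarrow> (\<forall>k<n. d k = 0)"
proof -
  obtain B where "finite_dimensional_vector_space vscale B"
    using assms by (auto simp: finite_dimensional_def)
  then interpret B: finite_dimensional_vector_space vscale B .
  interpret Fun: vector_space "\<lambda>c (T :: 'v \<Rightarrow> 'v) v. vscale c (T v)"
    by (rule vector_space_fun) (rule V.vector_space_axioms)
  obtain X where X: "finite X" "\<And>T. Vector_Spaces.linear vscale vscale T \<Longrightarrow> T \<in> Fun.span X"
    using B.linear_maps_finite_span by blast
  obtain n c where n: "act (s n) = (\<Sum>k<n. (\<lambda>v. vscale (c k) (act (s k) v)))"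
    and indep: "\<And>d. (\<Sum>k<n. (\<lambda>v. vscale (d k) (act (s k) v))) = 0 \<Longrightarrow> (\<forall>k<n. d k = 0)"
    by (rule Fun.first_dependent[OF X(1), of "\<lambda>k. act (s k)", OF X(2)[OF linear_act]]) blast
  define q where "q k = (if k = n then 1 else - c k)" for k
  have "act (\<Sum>k\<le>n. scale (q k) (s k)) v = 0" for v
  proof -
    have "(\<Sum>k<n. vscale (q k) (act (s k) v)) = - (\<Sum>k<n. vscale (c k) (act (s k) v))"
      unfolding sum_negf[symmetric] by (rule sum.cong) (auto simp: q_def)
    also have "\<dots> = - act (s n) v" unfolding n sum_fun_apply ..
    finally show ?thesis
      unfolding act_sum_left act_scale_left unfolding lessThan_Suc_atMost[symmetric] sum.lessThan_Suc
      by (simp add: q_def)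
  qed
  moreover have "\<forall>k<n. d k = 0" if "(\<Sum>k<n. scale (d k) (s k)) \<in> annihilator" for d
  proof (rule indep)
    show "(\<Sum>k<n. (\<lambda>v. vscale (d k) (act (s k) v))) = 0"
      using that by (simp add: fun_eq_iff sum_fun_apply annihilator_def act_sum_left act_scale_left)
  qed
  ultimately show thesis
    using that[of q n] by (simp add: annihilator_def q_def)
qed

end

locale current_algebra_module =
  lie_module scale bracket vscale act + current_algebra scale bracket e f h h1
  for scale :: "'f::{field_char_0, alg_closed_field} \<Rightarrow> 'l::ab_group_add \<Rightarrow> 'l"
    and bracket vscale and act :: "'l \<Rightarrow> 'v::ab_group_add \<Rightarrow> 'v" and e f h h1
begin

definition highest :: "(nat \<Rightarrow> 'f) \<Rightarrow> 'v \<Rightarrow> bool" where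
  "highest \<mu> v \<longleftrightarrow> (\<forall>k. act (E k) v = 0 \<and> act (H k) v = vscale (\<mu> k) v)"

text \<open>The eigenvalue is - \<mu> k, so that a highest weight vector and the lowest weight
  vector obtained from it share the same \<mu>.\<close>

definition lowest :: "(nat \<Rightarrow> 'f) \<Rightarrow> 'v \<Rightarrow> bool" where
  "lowest \<mu> v \<longleftrightarrow> (\<forall>k. act (F k) v = 0 \<and> act (H k) v = - vscale (\<mu> k) v)"

text \<open>If a is an eigenvalue of \<open>h\<close> but a + 1 is not, every \<open>E k\<close>
  kills the eigenspace of a, since it raises the weight by 1. For a common eigenvector of the
  infinitely many commuting \<open>H k\<close>, take a nonzero stable subspace of least dimension:
  an eigenspace of \<open>H k\<close> in it is again stable, hence all of it.\<close>

lemma highest_exists: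
  assumes fd: "finite_dimensional vscale" and "v0 \<noteq> (0 :: 'v)"
  obtains \<mu> v where "highest \<mu> v" "v \<noteq> 0"
proof -
  obtain B where "finite_dimensional_vector_space vscale B"
    using fd by (auto simp: finite_dimensional_def)
  then interpret B: finite_dimensional_vector_space vscale B .
  have span: "v \<in> V.span B" for v by (simp add: B.span_Basis)
  have eigen: "\<exists>a w. w \<in> U \<and> w \<noteq> 0 \<and> act b w = vscale a w"
    if "V.subspace U" "\<And>v. v \<in> U \<Longrightarrow> act b v \<in> U" "v \<in> U" "v \<noteq> 0" for U b v
  proof -
    have "U \<subseteq> V.span B" using span by blast
    then show ?thesis
      by (rule eigenvector_exists[OF linear_act B.finite_Basis _ that]) (assumption, blast)
  qed
  obtain a0 w0 where a0: "w0 \<noteq> 0" "act h w0 = vscale a0 w0"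
    using eigen[of UNIV h v0] \<open>v0 \<noteq> 0\<close> by auto
  have "\<exists>a. (\<exists>w. w \<noteq> 0 \<and> act h w = vscale a w) \<and> (\<forall>w. act h w = vscale (a + 1) w \<longrightarrow> w = 0)"
  proof (rule ccontr)
    assume *: "\<not> ?thesis"
    have "\<exists>w. w \<noteq> 0 \<and> act h w = vscale (a0 + of_nat n) w" for n
    proof (induction n)
      case 0
      then show ?case using a0 by auto
    next
      case (Suc n)
      then obtain w where "w \<noteq> 0" "act h w = vscale (a0 + of_nat n + 1) w" using * by blast
      then show ?case by (intro exI[of _ w]) (simp add: algebra_simps)
    qed
    then obtain s where s: "\<And>n. s n \<noteq> 0" "\<And>n. act h (s n) = vscale (a0 + of_nat n) (s n)" by metis
    have "inj (\<lambda>n. a0 + of_nat n :: 'f)" by (simp add: inj_on_def)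
    then obtain n where "s n = 0"
      by (rule V.eigenvector_sequence_has_zero[OF linear_act B.finite_Basis span _ s(2)])
    then show False using s(1) by simp
  qed
  then obtain a w1 where w1: "w1 \<noteq> 0" "act h w1 = vscale a w1"
    and top: "\<And>w. act h w = vscale (a + 1) w \<Longrightarrow> w = 0" by blast
  define inv where "inv U \<longleftrightarrow> V.subspace U \<and> (\<exists>v\<in>U. v \<noteq> 0) \<and>
    (\<forall>k. \<forall>v\<in>U. act (E k) v = 0 \<and> act (H k) v \<in> U)" for U
  have H_act: "act (H i) (act (H j) v) = act (H j) (act (H i) v)" for i j v
    using act_commute[of "H i" "H j" v] by (simp add: H_H)
  have "inv {v. act h v = vscale a v}"
  proof -
    have "act (E k) v = 0" if "act h v = vscale a v" for k v
      using act_commute[of h "E k" v] that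
      by (intro top) (simp add: act_scale_right V.scale_left_distrib)
    moreover have "act h (act (H k) v) = vscale a (act (H k) v)" if "act h v = vscale a v" for k v
      using H_act[of 0 k v] that by (simp add: act_scale_right)
    moreover have "V.subspace {v. act h v = vscale a v}"
      by (rule V.subspaceI)
        (simp_all add: act_add_right act_scale_right V.scale_right_distrib mult.commute)
    ultimately show ?thesis using w1 by (auto simp: inv_def)
  qed
  then obtain U where U: "inv U" and least: "\<And>U'. inv U' \<Longrightarrow> V.dim U \<le> V.dim U'"
    using ex_has_least_nat[of inv _ V.dim] by meson
  have sub: "V.subspace U" and EU: "\<And>k v. v \<in> U \<Longrightarrow> act (E k) v = 0"
    and HU: "\<And>k v. v \<in> U \<Longrightarrow> act (H k) v \<in> U"
    using U unfolding inv_def by blast+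
  obtain v where v: "v \<in> U" "v \<noteq> 0" using U unfolding inv_def by blast
  have "\<exists>c. \<forall>v\<in>U. act (H k) v = vscale c v" for k
  proof -
    obtain c w where w: "w \<in> U" "w \<noteq> 0" "act (H k) w = vscale c w"
      using eigen[OF sub HU v] by blast
    let ?U' = "U \<inter> {v. act (H k) v = vscale c v}"
    have "V.subspace {v. act (H k) v = vscale c v}"
      by (rule V.subspaceI)
        (simp_all add: act_add_right act_scale_right V.scale_right_distrib mult.commute)
    then have sub': "V.subspace ?U'" by (intro V.subspace_inter sub)
    have "act (H k) (act (H j) v) = vscale c (act (H j) v)"
      if "act (H k) v = vscale c v" for j v
      using H_act[of k j v] that by (simp add: act_scale_right)
    then have "inv ?U'" unfolding inv_def using sub' w EU HU by blast
    then have "?U' = U"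
      by (intro B.subspace_dim_equal sub' sub least) blast
    then show ?thesis by blast
  qed
  then obtain \<mu> where "\<And>k v. v \<in> U \<Longrightarrow> act (H k) v = vscale (\<mu> k) v" by metis
  then have "highest \<mu> v" using EU v by (simp add: highest_def)
  then show thesis using v(2) by (rule that)
qed

text \<open>At the last nonzero \<open>s d\<close> the left sides of \<open>H_s\<close> and
  \<open>E_s\<close>, which involve s (d + 1) = 0, vanish. What remains gives F k (s d) = 0 and H k
  (s d) = - \<mu> k (s d) for all k at once, after division by d + 1.\<close>

lemma lowest_exists:
  assumes fd: "finite_dimensional vscale" and v: "highest \<mu> v" "v \<noteq> 0"
  obtains w where "lowest \<mu> w" "w \<noteq> 0"
proof -
  obtain B where "finite_dimensional_vector_space vscale B"
    using fd by (auto simp: finite_dimensional_def)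
  then interpret B: finite_dimensional_vector_space vscale B .
  define s where "s n = (act f ^^ n) v" for n
  have s_0: "s 0 = v" and s_Suc: "s (Suc n) = act f (s n)" for n by (simp_all add: s_def)
  have F_f: "act (F k) (act f v) = act f (act (F k) v)" for k v
    using act_commute[of "F k" f v] F_F[of k 0] by simp
  have H_f: "act (H k) (act f v) = act f (act (H k) v) - act (F k) v" for k v
    using act_commute[of "H k" f v] H_F[of k 0] by simp
  have E_f: "act (E k) (act f v) = act f (act (E k) v) + act (H k) v" for k v
    using act_commute[of "E k" f v] E_F[of k 0] by simp
  have E_v: "act (E k) v = 0" and H_v: "act (H k) v = vscale (\<mu> k) v" for k
    using v by (simp_all add: highest_def)
  have H_s: "act (H k) (s (Suc n)) = vscale (\<mu> k) (s (Suc n)) - vscale (of_nat (Suc n)) (act (F k) (s n))" for k n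
  proof (induction n)
    case 0
    then show ?case by (simp add: s_Suc s_0 H_f H_v act_scale_right)
  next
    case (Suc n)
    have "act (H k) (s (Suc (Suc n))) = act f (act (H k) (s (Suc n))) - act (F k) (s (Suc n))"
      unfolding s_Suc[of "Suc n"] H_f ..
    also have "\<dots> = vscale (\<mu> k) (s (Suc (Suc n))) - vscale (of_nat (Suc n)) (act (F k) (s (Suc n)))
        - act (F k) (s (Suc n))"
      unfolding Suc act_diff_right act_scale_right F_f[symmetric] s_Suc[symmetric] ..
    finally show ?case by (simp add: V.scale_left_distrib V.scale_2)
  qed
  have E_s: "vscale 2 (act (E k) (s (Suc n))) =
      vscale (of_nat (Suc n)) (vscale (\<mu> k) (s n) + act (H k) (s n))" for k n
  proof (induction n)
    case 0
    then show ?case by (simp add: s_Suc s_0 E_f E_v H_v flip: V.scale_2)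
  next
    case (Suc n)
    have "vscale 2 (act (E k) (s (Suc (Suc n)))) =
        act f (vscale 2 (act (E k) (s (Suc n)))) + vscale 2 (act (H k) (s (Suc n)))"
      unfolding s_Suc[of "Suc n"] E_f by (simp add: act_scale_right V.scale_right_distrib)
    also have "act f (vscale 2 (act (E k) (s (Suc n)))) =
        act f (vscale (of_nat (Suc n)) (vscale (\<mu> k) (s n) + act (H k) (s n)))"
      unfolding Suc ..
    also have "\<dots> = vscale (of_nat (Suc n))
        (vscale (\<mu> k) (s (Suc n)) + (act (H k) (s (Suc n)) + act (F k) (s n)))"
      unfolding act_scale_right act_add_right s_Suc H_f by simp
    also have "\<dots> = vscale (of_nat (Suc n)) (vscale (\<mu> k) (s (Suc n)) + act (H k) (s (Suc n)))
        + (vscale (\<mu> k) (s (Suc n)) - act (H k) (s (Suc n)))"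
      unfolding H_s[of k n] by (simp only: V.scale_right_distrib) simp
    also have "\<dots> + vscale 2 (act (H k) (s (Suc n))) =
        vscale (of_nat (Suc n)) (vscale (\<mu> k) (s (Suc n)) + act (H k) (s (Suc n)))
        + (vscale (\<mu> k) (s (Suc n)) + act (H k) (s (Suc n)))"
      by (simp add: V.scale_2)
    also have "\<dots> = vscale (of_nat (Suc (Suc n))) (vscale (\<mu> k) (s (Suc n)) + act (H k) (s (Suc n)))"
      unfolding of_nat_Suc[of "Suc n"] V.scale_left_distrib V.scale_one by (rule add.commute)
    finally show ?case .
  qed
  \<comment> \<open>The \<open>s n\<close> have the distinct weights \<mu> 0 - n under
    \<open>h\<close>, so they cannot all be nonzero.\<close>
  have "\<exists>n. s n = 0"
  proof -
    have "act h (s n) = vscale (\<mu> 0 - of_nat n) (s n)" for n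
    proof (cases n)
      case 0
      then show ?thesis using H_v[of 0] by (simp add: s_0)
    next
      case (Suc m)
      then show ?thesis using H_s[of 0 m]
        by (simp add: V.scale_left_diff_distrib flip: s_Suc)
    qed
    moreover have "inj (\<lambda>n. \<mu> 0 - of_nat n)" by (simp add: inj_on_def)
    moreover have "s n \<in> V.span B" for n by (simp add: B.span_Basis)
    ultimately show ?thesis
      using V.eigenvector_sequence_has_zero[OF linear_act B.finite_Basis, of s _ h] by metis
  qed
  define n where "n = (LEAST n. s n = 0)"
  have "s n = 0" unfolding n_def using \<open>\<exists>n. s n = 0\<close> by (rule LeastI_ex)
  then obtain d where d: "n = Suc d" using s_0 v by (cases n) auto
  then have "s d \<noteq> 0" using not_less_Least[of d "\<lambda>n. s n = 0"] by (simp add: n_def)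
  have "s (Suc d) = 0" using \<open>s n = 0\<close> d by simp
  then have "act (F k) (s d) = 0" "vscale (\<mu> k) (s d) + act (H k) (s d) = 0" for k
    using H_s[of k d] E_s[of k d] by (simp_all del: of_nat_Suc)
  then have "lowest \<mu> (s d)" by (simp add: lowest_def eq_neg_iff_add_eq_0 add.commute)
  then show thesis using \<open>s d \<noteq> 0\<close> by (rule that)
qed

definition invariant :: "'v set \<Rightarrow> bool" where
  "invariant U \<longleftrightarrow> V.subspace U \<and> (\<forall>k. \<forall>v\<in>U. act (E k) v \<in> U \<and> act (F k) v \<in> U \<and> act (H k) v \<in> U)"

text \<open>\<open>G n\<close> is spanned by the n-fold products of elements \<open>F k\<close>
  applied to \<open>w\<close>. The \<open>E k\<close> lower n by one, the \<open>H k\<close>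
  preserve \<open>G n\<close>, and \<open>h\<close> acts on it by the scalar \<mu> 0 - n. So weight
  \<mu> 0 occurs only in \<open>G 0\<close>, which is the line of \<open>w\<close>.\<close>

lemma highest_generates:
  assumes w: "highest \<mu> w"
  obtains U where "invariant U" "w \<in> U"
    "\<And>v. v \<in> U \<Longrightarrow> act h v = vscale (\<mu> 0) v \<Longrightarrow> v \<in> V.span {w}"
proof -
  define G where "G = rec_nat (V.span {w}) (\<lambda>_ X. V.span (\<Union>k. act (F k) ` X))"
  have G_0: "G 0 = V.span {w}" and G_Suc: "G (Suc n) = V.span (\<Union>k. act (F k) ` G n)" for n
    by (simp_all add: G_def)
  have subspace_G: "V.subspace (G n)" for n by (cases n) (simp_all add: G_0 G_Suc)
  have F_G: "act (F k) v \<in> G (Suc n)" if "v \<in> G n" for k n v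
    using that by (auto simp: G_Suc intro!: V.span_base)
  have G_SucD: "v \<in> X"
    if "v \<in> G (Suc n)" "\<And>u j. u \<in> G n \<Longrightarrow> act (F j) u \<in> X" "V.subspace X" for v n X
  proof -
    have "V.span (\<Union>k. act (F k) ` G n) \<subseteq> X" using that by (intro V.span_minimal) auto
    then show ?thesis using that(1) unfolding G_Suc by blast
  qed
  have sub_vimage: "V.subspace {v. act a v \<in> X}" if "V.subspace X" for a X
    using that by (intro V.subspaceI)
      (auto simp: act_add_right act_scale_right V.subspace_0 V.subspace_add V.subspace_scale)
  have H_G: "act (H k) v \<in> G n" if "v \<in> G n" for k n v
    using that
  proof (induction n arbitrary: k v)
    case 0
    have "V.span {w} \<subseteq> {v. act (H k) v \<in> V.span {w}}"
      using w by (intro V.span_minimal sub_vimage)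
        (auto simp: highest_def intro: V.span_scale V.span_base)
    then show ?case using 0 by (auto simp: G_0)
  next
    case (Suc n)
    have "act (H k) (act (F j) u) \<in> G (Suc n)" if "u \<in> G n" for u j
      using Suc.IH[OF that] that act_commute[of "H k" "F j" u]
      by (auto simp: H_F intro!: V.subspace_diff[OF subspace_G] F_G)
    then show ?case
      using G_SucD[OF Suc.prems, of "{v. act (H k) v \<in> G (Suc n)}"] sub_vimage subspace_G by blast
  qed
  have E_G_0: "act (E k) v = 0" if "v \<in> G 0" for k v
    using that w by (auto simp: G_0 V.span_singleton highest_def act_scale_right)
  have E_G: "act (E k) v \<in> G n" if "v \<in> G (Suc n)" for k n v
    using that
  proof (induction n arbitrary: k v)
    case 0
    have "act (E k) (act (F j) u) \<in> G 0" if "u \<in> G 0" for u j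
      using that H_G[OF that] act_commute[of "E k" "F j" u] by (simp add: E_G_0 E_F)
    then show ?case
      using G_SucD[OF 0, of "{v. act (E k) v \<in> G 0}"] sub_vimage subspace_G by blast
  next
    case (Suc n)
    have "act (E k) (act (F j) u) \<in> G (Suc n)" if "u \<in> G (Suc n)" for u j
      using Suc.IH[OF that] H_G[OF that] act_commute[of "E k" "F j" u]
      by (auto simp: E_F intro!: V.subspace_add[OF subspace_G] F_G)
    then show ?case
      using G_SucD[OF Suc.prems, of "{v. act (E k) v \<in> G (Suc n)}"] sub_vimage subspace_G by blast
  qed
  have h_G: "act h v = vscale (\<mu> 0 - of_nat n) v" if "v \<in> G n" for n v
    using that
  proof (induction n arbitrary: v)
    case 0
    then show ?case using w H_0
      by (auto simp: G_0 V.span_singleton highest_def act_scale_right mult.commute dest: spec[of _ 0])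
  next
    case (Suc n)
    let ?X = "{v. act h v = vscale (\<mu> 0 - of_nat (Suc n)) v}"
    have "act h (act (F j) u) = vscale (\<mu> 0 - of_nat (Suc n)) (act (F j) u)" if "u \<in> G n" for u j
    proof -
      have "act h (act (F j) u) = act (F j) (act h u) - act (F j) u"
        using act_commute[of h "F j" u] H_F[of 0 j] by simp
      also have "\<dots> = vscale (\<mu> 0 - of_nat (Suc n)) (act (F j) u)"
        unfolding Suc.IH[OF that] act_scale_right by (simp add: algebra_simps)
      finally show ?thesis .
    qed
    moreover have "V.subspace ?X"
      by (rule V.subspaceI)
        (simp_all add: act_add_right act_scale_right V.scale_right_distrib mult.commute)
    ultimately show ?case using G_SucD[OF Suc.prems, of ?X] by blast
  qed
  define U where "U = V.span (\<Union>n. G n)"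
  have G_U: "v \<in> U" if "v \<in> G n" for v n using that by (auto simp: U_def intro: V.span_base)
  have stable: "act a v \<in> U" if "\<And>n v. v \<in> G n \<Longrightarrow> act a v \<in> U" "v \<in> U" for a v
  proof -
    have "V.span (\<Union>n. G n) \<subseteq> {v. act a v \<in> U}"
      using that(1) by (intro V.span_minimal sub_vimage) (auto simp: U_def)
    then show ?thesis using that(2) unfolding U_def[symmetric] by blast
  qed
  have "act (E k) v \<in> U" if "v \<in> G n" for k n v
  proof (cases n)
    case 0
    then show ?thesis using that E_G_0 by (simp add: U_def V.span_zero)
  next
    case (Suc m)
    then show ?thesis using that E_G G_U by blast
  qed
  then have "invariant U"
    unfolding invariant_def using stable F_G H_G G_U U_def by (metis V.subspace_span)
  moreover have "w \<in> U" by (rule G_U[of _ 0]) (simp add: G_0 V.span_base)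
  moreover have "v \<in> V.span {w}" if "v \<in> U" "act h v = vscale (\<mu> 0) v" for v
  proof -
    define D where "D = {x. \<exists>s N. (\<forall>n. s n \<in> G n) \<and> (\<forall>n\<ge>N. s n = 0) \<and> x = (\<Sum>n<N. s n)}"
    have "U \<subseteq> D"
      unfolding U_def
    proof (rule V.span_minimal)
      show "(\<Union>n. G n) \<subseteq> D"
      proof
        fix x assume "x \<in> (\<Union>n. G n)"
        then obtain n where "x \<in> G n" by auto
        then show "x \<in> D"
          unfolding D_def mem_Collect_eq
          by (intro exI[of _ "\<lambda>k. if k = n then x else 0"] exI[of _ "Suc n"])
            (auto simp: V.subspace_0[OF subspace_G])
      qed
      show "V.subspace D"
      proof (rule V.subspaceI)
        show "0 \<in> D"
          unfolding D_def mem_Collect_eq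
          by (intro exI[of _ "\<lambda>_. 0"] exI[of _ 0]) (auto simp: V.subspace_0[OF subspace_G])
      next
        fix x c assume "x \<in> D"
        then obtain s N where "\<And>n. s n \<in> G n" "\<And>n. n \<ge> N \<Longrightarrow> s n = 0" "x = (\<Sum>n<N. s n)"
          by (auto simp: D_def)
        then show "vscale c x \<in> D"
          unfolding D_def mem_Collect_eq
          by (intro exI[of _ "\<lambda>n. vscale c (s n)"] exI[of _ N])
            (auto simp: V.scale_sum_right V.subspace_scale[OF subspace_G])
      next
        fix x y assume "x \<in> D" "y \<in> D"
        then obtain s N t M where s: "\<And>n. s n \<in> G n" "\<And>n. n \<ge> N \<Longrightarrow> s n = 0" "x = (\<Sum>n<N. s n)"
          and t: "\<And>n. t n \<in> G n" "\<And>n. n \<ge> M \<Longrightarrow> t n = 0" "y = (\<Sum>n<M. t n)"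
          by (auto simp: D_def)
        have "x = (\<Sum>n<N + M. s n)" "y = (\<Sum>n<N + M. t n)"
          unfolding s(3) t(3) using s(2) t(2) by (intro sum.mono_neutral_left; auto)+
        then show "x + y \<in> D"
          unfolding D_def mem_Collect_eq
          by (intro exI[of _ "\<lambda>n. s n + t n"] exI[of _ "N + M"])
            (auto simp: sum.distrib s t V.subspace_add[OF subspace_G])
      qed
    qed
    then have "v \<in> D" using \<open>v \<in> U\<close> by blast
    then obtain s N where s: "\<And>n. s n \<in> G n" "\<And>n. n \<ge> N \<Longrightarrow> s n = 0" "v = (\<Sum>n<N. s n)"
      unfolding D_def by blast
    \<comment> \<open>Since \<open>v\<close> has the weight of \<open>s 0\<close>, subtracting it
      there gives a vanishing sum of vectors of distinct weights; hence v = s 0.\<close>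
    define t where "t n = (if n = 0 then s 0 - v else s n)" for n
    have "(\<Sum>n<Suc N. t n) = (\<Sum>n<Suc N. s n) - v"
      unfolding sum.lessThan_Suc_shift by (simp add: t_def)
    then have "(\<Sum>n<Suc N. t n) = 0" using s(2)[of N] by (simp add: s(3))
    moreover have "act h (t n) = vscale (\<mu> 0 - of_nat n) (t n)" for n
      using h_G[OF s(1)[of n]] that(2)
      by (cases "n = 0") (simp_all add: t_def act_diff_right V.scale_right_diff_distrib)
    moreover have "inj_on (\<lambda>n. \<mu> 0 - of_nat n) {..<Suc N}" by (simp add: inj_on_def)
    ultimately have "t 0 = 0"
      using V.eigenvectors_sum_zero[OF linear_act, of "{..<Suc N}" "\<lambda>n. \<mu> 0 - of_nat n" h t 0] by simp
    then show ?thesis using s(1)[of 0] by (simp add: t_def G_0)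
  qed
  ultimately show thesis by (rule that)
qed

end

section \<open>Modules for the tetrahedron algebra\<close>

context tetrahedron
begin

text \<open>In the realisation \<phi> fixes t and sends h to - h, e to 8 ((t - 1) / t) f and f to (1
  / 8) (t / (t - 1)) e. The two factors cancel in the bracket of \<phi> (E i) with \<phi> f, which
  leaves - H i.\<close>

lemma automorphism_H:
  assumes hom: "lie_algebra_hom scale bracket scale bracket \<phi>"
    and gens: "\<phi> x = - x" "\<phi> y = - v" "\<phi> z = - w" "\<phi> u = - u"
  shows "\<phi> (E 0) = scale 8 (F 0) + k" "\<phi> (E (Suc i)) = scale 8 (F (Suc i) - F i)" "\<phi> (H i) = - H i"
proof -
  interpret \<phi>: Vector_Spaces.linear scale scale \<phi> using hom by (simp add: lie_algebra_hom_def)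
  have br: "\<phi> \<langle>a, b\<rangle> = \<langle>\<phi> a, \<phi> b\<rangle>" for a b using hom by (simp add: lie_algebra_hom_def)
  have \<phi>_h: "\<phi> h = - h" by (simp add: h_def \<phi>.scale gens)
  have \<phi>_h1: "\<phi> h1 = - h1"
    unfolding h1_def \<phi>.scale \<phi>.add \<phi>.diff br gens \<phi>_h scale_minus_right[symmetric] by simp
  have F'_f: "scale 8 f = - F'" unfolding f_def by simp
  have \<phi>_e: "\<phi> (E 0) = scale 8 (F 0) + k"
    by (simp add: F'_f) (simp add: e_def \<phi>.add gens k_def)
  have \<phi>_f: "\<phi> f = scale (1 / 8) (e - g)"
  proof -
    have "\<phi> f = scale (- 1 / 8) (- x - w)" unfolding f_def \<phi>.scale \<phi>.add gens by simp
    also have "- x - w = - (e - g)" by (simp add: e_def g_def)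
    finally show ?thesis unfolding scale_minus_right by simp
  qed
  show "\<phi> (E 0) = scale 8 (F 0) + k" by (rule \<phi>_e)
  have \<phi>_E: "\<phi> (E (Suc i)) = scale 8 (F (Suc i) - F i)" for i
  proof (induction i)
    case 0
    have "\<phi> (E (Suc 0)) = \<langle>- h1, scale 8 (F 0) + k\<rangle>" unfolding h1_E[symmetric] br \<phi>_e \<phi>_h1 ..
    also have "\<dots> = scale 8 (F (Suc 0)) - scale 8 f"
      unfolding F'_f by (simp add: bracket_add_right bracket_scale_right h1_F[of 0, simplified] h1_k)
    finally show ?case by (simp add: scale_right_diff_distrib)
  next
    case (Suc i)
    have "\<phi> (E (Suc (Suc i))) = \<langle>- h1, scale 8 (F (Suc i) - F i)\<rangle>"
      unfolding h1_E[of "Suc i", symmetric] br Suc \<phi>_h1 ..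
    then show ?case by (simp add: bracket_diff_right bracket_scale_right)
  qed
  then show "\<phi> (E (Suc i)) = scale 8 (F (Suc i) - F i)" .
  show "\<phi> (H i) = - H i"
  proof (cases i)
    case (Suc j)
    have g_F: "\<langle>g, F (Suc j)\<rangle> = \<langle>g, F j\<rangle> - H j"
      using g_F_Suc[of g 1 "- 1" j] e_g h1_g g_F_1 by simp
    have "\<phi> (H i) = \<langle>F (Suc j) - F j, e - g\<rangle>"
      unfolding Suc H_def br \<phi>_E \<phi>_f bracket_scale_left bracket_scale_right by simp
    also have "\<dots> = - H i"
      using E_F[of 0 "Suc j"] E_F[of 0 j] bracket_anticommute[of "F (Suc j)" e]
        bracket_anticommute[of "F j" e] bracket_anticommute[of "F (Suc j)" g]
        bracket_anticommute[of "F j" g] Suc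
      by (simp add: bracket_diff_left bracket_diff_right g_F)
    finally show ?thesis .
  qed (simp add: \<phi>_h)
qed

end

locale tetrahedron_module =
  lie_module scale bracket vscale act + tetrahedron scale bracket x y z u v w
  for scale :: "'f::{field_char_0, alg_closed_field} \<Rightarrow> 'l::ab_group_add \<Rightarrow> 'l"
    and bracket vscale and act :: "'l \<Rightarrow> 'v::ab_group_add \<Rightarrow> 'v" and x y z u v w +
  assumes fd: "finite_dimensional vscale"
begin

sublocale current_algebra_module scale bracket vscale act e f h h1 ..

text \<open>The case c = 1, a = - 1 of the division argument, as e / (1 - t) = - e / (t -
  1).\<close>

lemma g_in_span_E: obtains n d where "g - (\<Sum>i<n. scale (d i) (E i)) \<in> annihilator"
proof -
  obtain n q where q: "(\<Sum>k\<le>n. scale (q k) (E k)) \<in> annihilator" "q n = 1"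
    "\<And>d. (\<Sum>k<n. scale (d k) (E k)) \<in> annihilator \<Longrightarrow> (\<forall>k<n. d k = 0)"
    by (rule first_dependent_mod_annihilator[OF fd, of E]) blast
  have "\<langle>h1, g\<rangle> = scale 1 g + scale (- 1) e" "\<langle>g, F 1\<rangle> = scale 1 \<langle>g, f\<rangle> + scale (- 1) h"
    by (simp_all add: h1_g g_F_1)
  note g_in_span_E_mod_ideal[OF e_g this h_g _ subspace_annihilator bracket_annihilator q]
  then obtain d where "g - (\<Sum>i<n. scale (d i) (E i)) \<in> annihilator" by auto
  then show thesis by (rule that)
qed

text \<open>After the exchange of \<open>e\<close> and \<open>f\<close>, multiplication by t is the
  bracket with - h1, and k = - 8 f / t is the case c = 0, a = - 8.\<close>

lemma k_in_span_F: obtains n d where "k - (\<Sum>i<n. scale (d i) (F i)) \<in> annihilator"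
proof -
  obtain n q where q: "(\<Sum>k\<le>n. scale (q k) (F k)) \<in> annihilator" "q n = 1"
    "\<And>d. (\<Sum>k<n. scale (d k) (F k)) \<in> annihilator \<Longrightarrow> (\<forall>k<n. d k = 0)"
    by (rule first_dependent_mod_annihilator[OF fd, of F]) blast
  have f_k: "\<langle>f, k\<rangle> = 0" unfolding f_def L.bracket_scale_left F'_k by simp
  have h1_k: "\<langle>- h1, k\<rangle> = scale 0 k + scale (- 8) f"
    unfolding L.bracket_minus_left h1_k by (simp add: f_def)
  have k_E1: "\<langle>k, E 1\<rangle> = scale 0 \<langle>k, e\<rangle> + scale (- 8) (- h)" using k_E_1 by simp
  have h_k: "\<langle>- h, k\<rangle> = k" by (simp add: h_k)
  note current_algebra.g_in_span_E_mod_ideal[OF swap, unfolded swap_E swap_F,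
      OF f_k h1_k k_E1 h_k _ subspace_annihilator bracket_annihilator q]
  then obtain d where "k - (\<Sum>i<n. scale (d i) (F i)) \<in> annihilator" by auto
  then show thesis by (rule that)
qed

lemma lowest_k:
  assumes "lowest \<mu> a"
  shows "act k a = 0"
proof -
  obtain n d where "k - (\<Sum>i<n. scale (d i) (F i)) \<in> annihilator" by (rule k_in_span_F)
  then have "act k a = (\<Sum>i<n. vscale (d i) (act (F i) a))"
    by (simp add: annihilator_def act_diff_left act_sum_left act_scale_left)
  then show ?thesis using assms by (simp add: lowest_def)
qed

text \<open>The elements \<open>x\<close>, \<open>y\<close>, \<open>z\<close>, \<open>u\<close> are
  combinations of \<open>E k\<close>, \<open>F k\<close> and \<open>H k\<close>. Only w = y - g and
  v = z - k need the expansions of \<open>g\<close> and \<open>k\<close> modulo the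
  annihilator.\<close>

lemma invariant_generators:
  assumes "invariant U" "b \<in> {x, y, z, u, v, w}" "a \<in> U"
  shows "act b a \<in> U"
proof -
  have U: "V.subspace U" and EFH: "act (E i) a \<in> U" "act (F i) a \<in> U" "act (H i) a \<in> U" for i
    using assms by (auto simp: invariant_def)
  note closed = V.subspace_diff[OF U] V.subspace_add[OF U] V.subspace_scale[OF U] V.subspace_sum[OF U]
    V.subspace_neg[OF U] EFH
  obtain n d where "g - (\<Sum>i<n. scale (d i) (E i)) \<in> annihilator" by (rule g_in_span_E)
  then have "act g a = (\<Sum>i<n. vscale (d i) (act (E i) a))"
    by (simp add: annihilator_def act_diff_left act_sum_left act_scale_left)
  then have g: "act g a \<in> U" by (auto intro!: closed)
  obtain n d where "k - (\<Sum>i<n. scale (d i) (F i)) \<in> annihilator" by (rule k_in_span_F)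
  then have "act k a = (\<Sum>i<n. vscale (d i) (act (F i) a))"
    by (simp add: annihilator_def act_diff_left act_sum_left act_scale_left)
  then have k: "act k a \<in> U" by (auto intro!: closed)
  have "act (h + h) a \<in> U" unfolding act_add_left using EFH(3)[of 0] by (auto intro!: closed)
  then have x: "act x a \<in> U" unfolding h_h .
  have ef: "act e a \<in> U" "act f a \<in> U" using EFH(1,2)[of 0] by simp_all
  have "act y a = act e a - act x a" unfolding act_diff_left[symmetric] by (simp add: e_def)
  also have "\<dots> \<in> U" using x ef by (intro closed)
  finally have y: "act y a \<in> U" .
  have "act z a = - vscale 8 (act f a) - act x a"
    unfolding act_diff_left[symmetric] act_scale_left[symmetric] act_minus_left[symmetric]
    by (simp add: f_def)
  also have "\<dots> \<in> U" using x ef by (intro closed)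
  finally have z: "act z a \<in> U" .
  have "act w a = act y a - act g a" unfolding act_diff_left[symmetric] by (simp add: g_def)
  also have "\<dots> \<in> U" using y g by (intro closed)
  finally have w: "act w a \<in> U" .
  have "act v a = act z a - act k a" unfolding act_diff_left[symmetric] by (simp add: k_def)
  also have "\<dots> \<in> U" using z k by (intro closed)
  finally have v: "act v a \<in> U" .
  \<comment> \<open>This is Q = t e + 8 (1 - t) f, the part of \<open>u\<close> of nonzero weight;
    the rest of \<open>u\<close> is x - 4 h1.\<close>
  have "scale 8 (F 0 - F 1) + E 1 = scale (1 / 2) (m + p)"
    unfolding One_nat_def F_1 E_1 by (simp only: F_0 L.scale_right_distrib diff_diff_eq2 add_diff_cancel_left') simp
  also have "m + p = scale 2 Q" by (simp add: L.scale_2)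
  finally have Q: "scale 8 (F 0 - F 1) + E 1 = Q" by simp
  have u: "x + Q - scale 4 (H 1) = u" unfolding One_nat_def H_1 by (simp add: h1_def)
  have "act u a = act (x + (scale 8 (F 0 - F 1) + E 1) - scale 4 (H 1)) a"
    unfolding Q u ..
  also have "\<dots> = act x a + (vscale 8 (act (F 0) a - act (F 1) a) + act (E 1) a) - vscale 4 (act (H 1) a)"
    unfolding act_diff_left act_add_left act_scale_left ..
  also have "\<dots> \<in> U" using x by (intro closed)
  finally have "act u a \<in> U" .
  then show ?thesis using assms(2) x y z w v by blast
qed

end

section \<open>Direct sums of two modules and their submodules\<close>

lemma lie_module_prod:
  fixes scale :: "'f::field \<Rightarrow> 'l::ab_group_add \<Rightarrow> 'l"
  assumes "lie_module scale bracket vscale act" "lie_module scale bracket wscale act'"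
  shows "lie_module scale bracket (module_prod.scale vscale wscale) (\<lambda>\<xi>. map_prod (act \<xi>) (act' \<xi>))"
proof -
  interpret M: lie_module scale bracket vscale act by fact
  interpret M': lie_module scale bracket wscale act' by fact
  interpret P: vector_space_prod vscale wscale by unfold_locales
  show ?thesis
  proof (intro lie_module.intro lie_module_axioms.intro M.L.lie_algebra_axioms P.p.vector_space_axioms)
    fix a b t
    show "map_prod (act (bracket a b)) (act' (bracket a b)) t =
        map_prod (act a) (act' a) (map_prod (act b) (act' b) t) -
        map_prod (act b) (act' b) (map_prod (act a) (act' a) t)"
      by (cases t) (simp only: map_prod_simp minus_prod_def fst_conv snd_conv M.act_bracket M'.act_bracket)
  qed (simp_all add: prod_eq_iff P.scale_def M.act_add_left M'.act_add_left M.act_scale_left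
      M'.act_scale_left M.act_add_right M'.act_add_right M.act_scale_right M'.act_scale_right)
qed

text \<open>A form of Goursat's lemma. The vectors a with (a, 0) \<in> U form a submodule that
  misses p, hence it is zero, and likewise on the other side. The two projections of U are
  submodules containing p and q, which are nonzero, so they are everything.\<close>

lemma isomorphic_modules_graph:
  fixes scale :: "'f::field \<Rightarrow> 'l::ab_group_add \<Rightarrow> 'l"
  assumes "lie_module scale bracket vscale act" "lie_module scale bracket wscale act'"
    and irr: "irreducible_module vscale act" "irreducible_module wscale act'"
    and U: "submodule (module_prod.scale vscale wscale) (\<lambda>\<xi>. map_prod (act \<xi>) (act' \<xi>)) U"
    and pq: "(p, q) \<in> U" "(p, 0) \<notin> U" "(0, q) \<notin> U"
  shows "isomorphic_modules vscale act wscale act'"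
proof -
  interpret M: lie_module scale bracket vscale act by fact
  interpret M': lie_module scale bracket wscale act' by fact
  interpret P: vector_space_prod vscale wscale by unfold_locales
  have sub: "P.p.subspace U" using U by (simp add: submodule_def)
  have "map_prod (act \<xi>) (act' \<xi>) t \<in> U" if "t \<in> U" for \<xi> t
    using U that by (simp add: submodule_def)
  from this[of "(a, b)" for a b] have actU: "(act \<xi> a, act' \<xi> b) \<in> U" if "(a, b) \<in> U" for \<xi> a b
    using that by simp
  have zero: "(0, 0) \<in> U" using P.p.subspace_0[OF sub] by (simp only: zero_prod_def)
  have add: "(a + c, b + d) \<in> U" if "(a, b) \<in> U" "(c, d) \<in> U" for a b c d
    using P.p.subspace_add[OF sub that] by simp
  have diff: "(a - c, b - d) \<in> U" if "(a, b) \<in> U" "(c, d) \<in> U" for a b c d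
    using P.p.subspace_diff[OF sub that] by simp
  have scl: "(vscale c a, wscale c b) \<in> U" if "(a, b) \<in> U" for a b c
    using P.p.subspace_scale[OF sub that, of c] by (simp add: P.scale_def)
  have "M.V.subspace {a. (a, 0) \<in> U}"
    by (rule M.V.subspaceI) (use zero add[of _ 0 _ 0] scl[of _ 0] in simp_all)
  then have "submodule vscale act {a. (a, 0) \<in> U}"
    using actU[of _ 0] by (simp add: submodule_def)
  then have "{a. (a, 0) \<in> U} = {0}" using irr(1) pq unfolding irreducible_module_def by blast
  then have fst0: "a = 0" if "(a, 0) \<in> U" for a using that by blast
  have "M'.V.subspace {b. (0, b) \<in> U}"
    by (rule M'.V.subspaceI) (use zero add[of 0 _ 0] scl[of 0] in simp_all)
  then have "submodule wscale act' {b. (0, b) \<in> U}"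
    using actU[of 0] by (simp add: submodule_def)
  then have "{b. (0, b) \<in> U} = {0}" using irr(2) pq unfolding irreducible_module_def by blast
  then have snd0: "b = 0" if "(0, b) \<in> U" for b using that by blast
  have "p \<noteq> 0" "q \<noteq> 0" using pq by auto
  have "M.V.subspace {a. \<exists>b. (a, b) \<in> U}"
    by (rule M.V.subspaceI) (use zero add scl in blast)+
  then have "submodule vscale act {a. \<exists>b. (a, b) \<in> U}"
    unfolding submodule_def using actU by blast
  then have "{a. \<exists>b. (a, b) \<in> U} = UNIV"
    using irr(1) pq(1) \<open>p \<noteq> 0\<close> unfolding irreducible_module_def by blast
  then have "\<forall>a. \<exists>b. (a, b) \<in> U" by blast
  from choice[OF this] obtain \<phi> where \<phi>: "\<And>a. (a, \<phi> a) \<in> U" by blast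
  have "M'.V.subspace {b. \<exists>a. (a, b) \<in> U}"
    by (rule M'.V.subspaceI) (use zero add scl in blast)+
  then have "submodule wscale act' {b. \<exists>a. (a, b) \<in> U}"
    unfolding submodule_def using actU by blast
  then have sndU: "{b. \<exists>a. (a, b) \<in> U} = UNIV"
    using irr(2) pq(1) \<open>q \<noteq> 0\<close> unfolding irreducible_module_def by blast
  have \<phi>_eq: "\<phi> a = b" if "(a, b) \<in> U" for a b
    using snd0[of "\<phi> a - b"] diff[OF \<phi>[of a] that] by simp
  have "Vector_Spaces.linear vscale wscale \<phi>"
    unfolding Vector_Spaces.linear_iff
    by (intro conjI allI M.V.vector_space_axioms M'.V.vector_space_axioms
        \<phi>_eq[OF add[OF \<phi> \<phi>]] \<phi>_eq[OF scl[OF \<phi>]])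
  moreover have "bij \<phi>"
  proof (rule bijI)
    show "inj \<phi>"
    proof (rule injI)
      fix a b assume "\<phi> a = \<phi> b"
      then show "a = b" using fst0[of "a - b"] diff[OF \<phi>[of a] \<phi>[of b]] by simp
    qed
    show "surj \<phi>"
    unfolding surj_def
    proof
      fix b
      obtain a where "(a, b) \<in> U" using sndU by blast
      then show "\<exists>a. b = \<phi> a" using \<phi>_eq[of a b] by (intro exI[of _ a]) simp
    qed
  qed
  moreover have "\<phi> (act \<xi> a) = act' \<xi> (\<phi> a)" for \<xi> a by (rule \<phi>_eq[OF actU[OF \<phi>]])
  ultimately show ?thesis unfolding isomorphic_modules_def by blast
qed

section \<open>Twisting by the Klein four-group\<close>

lemma tet_x_flip: "i \<noteq> j \<Longrightarrow> tet_x j i = - tet_x i j"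
  using tet_relations(1)[of i j] by (simp add: eq_neg_iff_add_eq_0 add.commute)

text \<open>The order of the indices is left free so that each involution in G can be treated as (a
  d)(b c).\<close>

lemma tetrahedron_tet:
  assumes "distinct [a, b, c, d]"
  shows "tetrahedron (tet_scale :: 'f::field_char_0 \<Rightarrow> _) tet_bracket
    (tet_x b c) (tet_x c d) (tet_x d b) (tet_x a d) (tet_x a b) (tet_x c a)"
proof -
  have flip: "tet_x j i = - (tet_x i j :: 'f tet)" if "i \<noteq> j" for i j
    using that by (rule tet_x_flip)
  have rel: "tet_bracket (tet_x i j) (tet_x j k) = tet_scale 2 (tet_x i j) + tet_scale 2 (tet_x j k :: 'f tet)"
    if "distinct [i, j, k]" for i j k
    by (rule tet_relations(2)) (use that in simp)
  have rel': "tet_bracket (tet_x i j) (tet_x k j) = tet_scale 2 (tet_x k j) - tet_scale 2 (tet_x i j :: 'f tet)"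
    if "distinct [i, j, k]" for i j k
    using rel[OF that] that flip[of j k] by simp
  have rel'': "tet_bracket (tet_x j i) (tet_x j k) = tet_scale 2 (tet_x j i) - tet_scale 2 (tet_x j k :: 'f tet)"
    if "distinct [i, j, k]" for i j k
    using rel[OF that] that flip[of i j] by simp
  have rel''': "tet_bracket (tet_x j k) (tet_x i j) = - tet_scale 2 (tet_x j k) - tet_scale 2 (tet_x i j :: 'f tet)"
    if "distinct [i, j, k]" for i j k
    using rel[OF that] tet.bracket_anticommute[of "tet_x j k :: 'f tet" "tet_x i j"] by simp
  show ?thesis
    by (intro tetrahedron.intro tetrahedron_axioms.intro tet.lie_algebra_axioms
        rel rel' rel'' rel''' tet_relations(3)) (use assms in auto)
qed

text \<open>An involution permutes the acting elements, so both actions have the same stable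
  subspaces.\<close>

lemma (in lie_module) submodule_pullback:
  assumes "submodule vscale (act \<circ> \<phi>) W" "\<And>\<xi>. \<phi> (\<phi> \<xi>) = \<xi>"
  shows "submodule vscale act W"
  using assms unfolding submodule_def comp_def by metis

lemma twist_isomorphic:
  fixes act :: "'f::{alg_closed_field, field_char_0} tet \<Rightarrow> 'v::ab_group_add \<Rightarrow> 'v"
  assumes M: "tet_module vscale act" and fd: "finite_dimensional vscale"
    and irr: "irreducible_module vscale act"
    and dist: "distinct [a, b, c, d]"
    and \<sigma>: "Perm.apply \<sigma> a = d" "Perm.apply \<sigma> b = c" "Perm.apply \<sigma> c = b" "Perm.apply \<sigma> d = a"
  shows "isomorphic_modules vscale (\<lambda>\<xi>. act (perm_tet \<sigma> \<xi>)) vscale act"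
proof -
  let ?X = "tet_x :: 4 \<Rightarrow> 4 \<Rightarrow> 'f tet"
  let ?\<phi> = "perm_tet \<sigma> :: 'f tet \<Rightarrow> 'f tet"
  define act' where "act' \<xi> = act (?\<phi> \<xi>)" for \<xi>
  have idx: "i = a \<or> i = b \<or> i = c \<or> i = d" for i
  proof -
    have "card {a, b, c, d} = CARD(4)" using dist by simp
    then have "{a, b, c, d} = (UNIV :: 4 set)" by (metis card_subset_eq finite subset_UNIV)
    then show ?thesis by blast
  qed
  have "Perm.apply \<sigma> (Perm.apply \<sigma> i) = i" for i using idx[of i] \<sigma> by auto
  then have "\<sigma> * \<sigma> = 1" by (intro perm_eqI) (simp add: apply_times)
  then have involution: "?\<phi> (?\<phi> \<xi>) = \<xi>" for \<xi> by (simp flip: perm_tet_times add: perm_tet_one)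
  interpret T: tetrahedron "tet_scale :: 'f \<Rightarrow> _" tet_bracket "?X b c" "?X c d" "?X d b" "?X a d" "?X a b" "?X c a"
    by (rule tetrahedron_tet[OF dist])
  interpret M: tetrahedron_module tet_scale tet_bracket vscale act
      "?X b c" "?X c d" "?X d b" "?X a d" "?X a b" "?X c a"
    by (intro tetrahedron_module.intro tetrahedron_module_axioms.intro M fd T.tetrahedron_axioms)
  have M': "tet_module vscale act'"
    using M.act_add_left M.act_scale_left M.act_add_right M.act_scale_right M.act_bracket
    by unfold_locales (simp_all add: act'_def)
  obtain v0 :: 'v where "v0 \<noteq> 0" using irr by (auto simp: irreducible_module_def)
  then obtain \<mu> v where v: "M.highest \<mu> v" "v \<noteq> 0" by (rule M.highest_exists[OF fd])
  then obtain w where w: "M.lowest \<mu> w" "w \<noteq> 0" by (rule M.lowest_exists[OF fd])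
  have flip: "?X j i = - ?X i j" if "i \<noteq> j" for i j using that by (rule tet_x_flip)
  have "c \<noteq> a" "d \<noteq> b" using dist by auto
  then have gens: "?\<phi> (?X b c) = - ?X b c" "?\<phi> (?X c d) = - ?X a b" "?\<phi> (?X d b) = - ?X c a" "?\<phi> (?X a d) = - ?X a d"
    using dist \<sigma> flip[of b c] flip[of a b] flip[of c a] flip[of a d]
    by (simp_all add: perm_tet_gen)
  note \<phi> = T.automorphism_H[OF perm_tet_hom gens]
  \<comment> \<open>The automorphism sends each \<open>E i\<close> to a combination of elements
    \<open>F j\<close> and \<open>k\<close>, and all of these kill the lowest weight vector
    \<open>w\<close>.\<close>
  have w': "act' (T.E i) w = 0 \<and> act' (T.H i) w = vscale (\<mu> i) w" for i
  proof
    have F: "act (T.F i) w = 0" and H: "act (T.H i) w = - vscale (\<mu> i) w" for i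
      using w by (simp_all add: M.lowest_def)
    show "act' (T.E i) w = 0"
    proof (cases i)
      case 0
      then show ?thesis
        unfolding act'_def 0 \<phi>(1) M.act_add_left M.act_scale_left F M.lowest_k[OF w(1)] by simp
    next
      case (Suc j)
      show ?thesis unfolding act'_def Suc \<phi>(2) M.act_scale_left M.act_diff_left F by simp
    qed
    show "act' (T.H i) w = vscale (\<mu> i) w" unfolding act'_def \<phi>(3) M.act_minus_left H by simp
  qed
  obtain B where "finite_dimensional_vector_space vscale B" using fd by (auto simp: finite_dimensional_def)
  then interpret B: finite_dimensional_vector_space vscale B .
  interpret P: finite_dimensional_vector_space_prod vscale vscale B B by unfold_locales
  have fdP: "finite_dimensional P.scale"
    unfolding finite_dimensional_def using P.p.finite_dimensional_vector_space_axioms by blast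
  define actP where "actP \<xi> = map_prod (act' \<xi>) (act \<xi>)" for \<xi>
  have P: "tet_module P.scale actP" using lie_module_prod[OF M' M] unfolding actP_def .
  interpret PM: tetrahedron_module tet_scale tet_bracket P.scale actP
      "?X b c" "?X c d" "?X d b" "?X a d" "?X a b" "?X c a"
    by (intro tetrahedron_module.intro tetrahedron_module_axioms.intro P fdP T.tetrahedron_axioms)
  have "PM.highest \<mu> (w, v)"
    using v w' unfolding PM.highest_def M.highest_def by (simp add: actP_def P.scale_def zero_prod_def)
  then obtain U where U: "PM.invariant U" "(w, v) \<in> U"
    and top: "\<And>t. t \<in> U \<Longrightarrow> actP T.h t = P.scale (\<mu> 0) t \<Longrightarrow> t \<in> P.p.span {(w, v)}"
    by (rule PM.highest_generates) blast
  have subU: "P.p.subspace U" using U by (simp add: PM.invariant_def)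
  have "\<forall>t\<in>U. actP \<xi> t \<in> U" for \<xi>
  proof (induction \<xi> rule: tet_induct)
    case (gen i j)
    have 1: "\<forall>t\<in>U. actP \<xi> t \<in> U" if "\<xi> \<in> {?X b c, ?X c d, ?X d b, ?X a d, ?X a b, ?X c a}" for \<xi>
      using PM.invariant_generators[OF U(1) that] by blast
    then have 2: "\<forall>t\<in>U. actP \<xi> t \<in> U" if "- \<xi> \<in> {?X b c, ?X c d, ?X d b, ?X a d, ?X a b, ?X c a}" for \<xi>
      using that P.p.subspace_neg[OF subU] PM.act_minus_left[of "- \<xi>"] by (metis minus_minus)
    \<comment> \<open>Up to sign, the six elements are all twelve generators.\<close>
    have "?X i j \<in> {?X b c, ?X c d, ?X d b, ?X a d, ?X a b, ?X c a} \<or>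
        - ?X i j \<in> {?X b c, ?X c d, ?X d b, ?X a d, ?X a b, ?X c a}"
      using idx[of i] idx[of j] gen flip[of i j] by auto
    then show ?case using 1 2 by blast
  next
    case zero
    then show ?case using P.p.subspace_0[OF subU] by simp
  next
    case (add u v)
    then show ?case using P.p.subspace_add[OF subU] by (simp add: PM.act_add_left)
  next
    case (neg u)
    then show ?case using P.p.subspace_neg[OF subU] by simp
  next
    case (scale a u)
    then show ?case using P.p.subspace_scale[OF subU] by (simp add: PM.act_scale_left)
  next
    case (bracket u v)
    then show ?case using P.p.subspace_diff[OF subU] by (simp add: PM.act_bracket)
  qed
  then have U_sub: "submodule P.scale actP U" using subU by (simp add: submodule_def)
  have irr': "irreducible_module vscale act'"
    using irr M.submodule_pullback[of ?\<phi>] involution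
    unfolding irreducible_module_def act'_def comp_def by blast
  have h: "act' T.h w = vscale (\<mu> 0) w" "act T.h v = vscale (\<mu> 0) v"
    using w'[of 0] v by (auto simp: M.highest_def dest: spec[of _ 0])
  have "(w, 0) \<notin> U"
  proof
    assume "(w, 0) \<in> U"
    then have "(w, 0) \<in> P.p.span {(w, v)}"
      by (rule top) (simp add: actP_def h P.scale_def)
    then show False using v(2) w(2) by (auto simp: P.p.span_singleton P.scale_def)
  qed
  moreover have "(0, v) \<notin> U"
  proof
    assume "(0, v) \<in> U"
    then have "(0, v) \<in> P.p.span {(w, v)}"
      by (rule top) (simp add: actP_def h P.scale_def M.act_0_right act'_def)
    then show False using v(2) w(2) by (auto simp: P.p.span_singleton P.scale_def)
  qed
  ultimately have "isomorphic_modules vscale act' vscale act"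
    using isomorphic_modules_graph[OF M' M irr' irr] U_sub U(2) unfolding actP_def by blast
  then show ?thesis unfolding act'_def .
qed

theorem corollary15p5:
  fixes vscale :: "'f::{alg_closed_field, field_char_0} \<Rightarrow> 'v::ab_group_add \<Rightarrow> 'v"
    and act :: "'f tet \<Rightarrow> 'v \<Rightarrow> 'v"
    and \<sigma> :: "4 perm"
  assumes "tet_module vscale act"
    and "finite_dimensional vscale"
    and "irreducible_module vscale act"
    and "\<sigma> \<in> klein_four"
  shows "isomorphic_modules vscale (twist \<sigma> act) vscale act"
proof (cases "\<sigma> = 1")
  case True
  interpret lie_module tet_scale tet_bracket vscale act by fact
  have "twist \<sigma> act = act" by (simp add: twist_def True perm_tet_one fun_eq_iff)
  then show ?thesis
    unfolding isomorphic_modules_def by (intro exI[of _ id]) (simp add: V.linear_id)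
next
  case False
  define \<tau> where "\<tau> = inverse \<sigma>"
  \<comment> \<open>Twisting acts through the inverse of \<sigma>. The four equations for \<sigma>,
    read backwards, give the same four for \<tau>.\<close>
  have inv: "Perm.apply \<tau> j = i" if "Perm.apply \<sigma> i = j" for i j
    unfolding \<tau>_def apply_inverse by (rule inv_f_eq) (use that in \<open>simp_all add: inj_def apply_inj\<close>)
  let ?P = "\<lambda>a b c d. distinct [a, b, c, d] \<and> Perm.apply \<sigma> a = d \<and> Perm.apply \<sigma> b = c \<and>
      Perm.apply \<sigma> c = b \<and> Perm.apply \<sigma> d = a"
  consider "\<sigma> = Perm.swap 0 1 * Perm.swap 2 3" | "\<sigma> = Perm.swap 0 2 * Perm.swap 1 3"
    | "\<sigma> = Perm.swap 0 3 * Perm.swap 1 2"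
    using assms(4) False by (auto simp: klein_four_def)
  then have "\<exists>a b c d. ?P a b c d"
  proof cases
    case 1
    then have "?P 0 2 3 1" by (simp add: apply_times swap.rep_eq transpose_def)
    then show ?thesis by blast
  next
    case 2
    then have "?P 0 1 3 2" by (simp add: apply_times swap.rep_eq transpose_def)
    then show ?thesis by blast
  next
    case 3
    then have "?P 0 1 2 3" by (simp add: apply_times swap.rep_eq transpose_def)
    then show ?thesis by blast
  qed
  then obtain a b c d where "distinct [a, b, c, d]" "Perm.apply \<tau> a = d" "Perm.apply \<tau> b = c"
      "Perm.apply \<tau> c = b" "Perm.apply \<tau> d = a"
    using inv by metis
  then have "isomorphic_modules vscale (\<lambda>\<xi>. act (perm_tet \<tau> \<xi>)) vscale act"
    by (rule twist_isomorphic[OF assms(1-3)])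
  moreover have "twist \<sigma> act = (\<lambda>\<xi>. act (perm_tet \<tau> \<xi>))"
    by (simp add: twist_def \<tau>_def fun_eq_iff)
  ultimately show ?thesis by simp
qed

end
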